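(* Let $P\subset\mathbb{R}^d$ be a proper locally anti-blocking polytope. Then $s(P)\ge 3^d$. Moreover, $s(P)=3^d$ if and only if $P$ is a generalized Hanner polytope.
   Context: For $J\subseteq[d]=\{1,\dots,d\}$ let $\mathbb{R}^d_J=\operatorname{span}\{e_i: i\in J\}$ and let $\pi_J:\mathbb{R}^d\to\mathbb{R}^d_J$ be the orthogonal projection. A polytope $P\subset\mathbb{R}^d$ is locally anti-blocking if $\pi_J(x)\in P$ for all $x\in P$ and all $J\subseteq[d]$ (equivalently $\pi_J(P)=P\cap\mathbb{R}^d_J$ for all $J$); it is proper if the origin lies in its interior. $s(P)$ is the number of non-empty faces of $P$. Generalized Hanner polytopes are defined recursively: in dimension $1$, a line segment containing the origin in its interior; in dimension $d\ge2$, (up to a permutation of coordinates) either a Cartesian product $P_1\times P_2\subset\mathbb{R}^{d_1}\times\mathbb{R}^{d_2}$ or a free sum $P_1\oplus P_2:=\operatorname{conv}(P_1\times\{0\}\cup\{0\}\times P_2)$ of two generalized Hanner polytopes $P_1\subset\mathbb{R}^{d_1}$, $P_2\subset\mathbb{R}^{d_2}$ of lower dimensions $d_1+d_2=d$, $d_1,d_2\ge1$. *)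

theory Defs
  imports "HOL-Analysis.Analysis"
begin

definition coord_subspace :: "'n set \<Rightarrow> (real ^ 'n::finite) set" where
  "coord_subspace J = span ((\<lambda>i. axis i 1) ` J)"

definition coord_proj :: "'n set \<Rightarrow> real ^ 'n::finite \<Rightarrow> real ^ 'n" where
  "coord_proj J x = (\<chi> i. if i \<in> J then x $ i else 0)"

text \<open>The next two facts say that \<open>coord_proj J\<close> is the orthogonal projection onto
  \<open>coord_subspace J\<close>.\<close>

lemma coord_proj_in_coord_subspace: "coord_proj J x \<in> coord_subspace J"
proof -
  have "coord_proj J x = (\<Sum>i\<in>J. (x $ i) *\<^sub>R axis i 1)"
    by (simp add: coord_proj_def vec_eq_iff axis_def if_distrib [where f = "\<lambda>t. _ * t"]
        sum.delta' cong: if_cong)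
  also have "\<dots> \<in> coord_subspace J"
    unfolding coord_subspace_def by (intro span_sum span_scale span_base imageI)
  finally show ?thesis .
qed

lemma coord_proj_orthogonal:
  assumes "y \<in> coord_subspace J"
  shows "orthogonal (x - coord_proj J x) y"
  using assms unfolding coord_subspace_def
  by (rule orthogonal_to_span)
    (auto simp: orthogonal_def coord_proj_def inner_axis)

definition locally_anti_blocking :: "(real ^ 'n::finite) set \<Rightarrow> bool" where
  "locally_anti_blocking P \<longleftrightarrow> (\<forall>J. \<forall>x\<in>P. coord_proj J x \<in> P)"

text \<open>In \<open>(face_of)\<close> a polytope is a face of itself and the empty set is a face.\<close>

definition num_nonempty_faces :: "(real ^ 'n::finite) set \<Rightarrow> nat" where
  "num_nonempty_faces P = card {F. F face_of P \<and> F \<noteq> {}}"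

text \<open>The recursion over the dimension is carried out inside one ambient space:
  \<open>generalized_hanner_on J P\<close> says that \<open>P\<close>, a subset of the coordinate subspace indexed by the
  non-empty set \<open>J\<close>, is a generalized Hanner polytope of dimension \<open>card J\<close> in that subspace.
  Splitting \<open>J\<close> into arbitrary disjoint parts accounts for permutations of coordinates.
  As the coordinate subspaces of disjoint \<open>J\<^sub>1\<close> and \<open>J\<^sub>2\<close> are complementary in that of
  \<open>J\<^sub>1 \<union> J\<^sub>2\<close>, the Cartesian product is the set of sums \<open>x + y\<close>, and \<open>P\<^sub>1 \<times> {0}\<close>,
  \<open>{0} \<times> P\<^sub>2\<close> are \<open>P\<^sub>1\<close>, \<open>P\<^sub>2\<close> themselves.\<close>

inductive generalized_hanner_on :: "'n set \<Rightarrow> (real ^ 'n::finite) set \<Rightarrow> bool" where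
  segment: "a < 0 \<Longrightarrow> 0 < b \<Longrightarrow>
    generalized_hanner_on {i} (closed_segment (axis i a) (axis i b))"
| product: "generalized_hanner_on J\<^sub>1 P\<^sub>1 \<Longrightarrow> generalized_hanner_on J\<^sub>2 P\<^sub>2 \<Longrightarrow> J\<^sub>1 \<inter> J\<^sub>2 = {} \<Longrightarrow>
    generalized_hanner_on (J\<^sub>1 \<union> J\<^sub>2) {x + y | x y. x \<in> P\<^sub>1 \<and> y \<in> P\<^sub>2}"
| free_sum: "generalized_hanner_on J\<^sub>1 P\<^sub>1 \<Longrightarrow> generalized_hanner_on J\<^sub>2 P\<^sub>2 \<Longrightarrow> J\<^sub>1 \<inter> J\<^sub>2 = {} \<Longrightarrow>
    generalized_hanner_on (J\<^sub>1 \<union> J\<^sub>2) (convex hull (P\<^sub>1 \<union> P\<^sub>2))"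

definition generalized_hanner :: "(real ^ 'n::finite) set \<Rightarrow> bool" where
  "generalized_hanner P \<longleftrightarrow> generalized_hanner_on UNIV P"

end

theory Submission
  imports Defs
begin

text \<open>
  Call a face \<open>F\<close> of \<open>P\<close> good for a sign vector \<open>\<tau> \<in> {-1, 0, 1}\<^sup>d\<close> if some relative interior point
  of \<open>F\<close> and some normal vector of \<open>F\<close> both have sign vector \<open>\<tau>\<close>. Projecting coordinates away shows that
  a face is good for at most one \<open>\<tau>\<close>; maximizing the product of the coordinates in the support
  of \<open>\<tau>\<close> shows that each \<open>\<tau>\<close> has a good face. This gives the lower bound.

  In case of equality every face is good, and any two pairs of a point and a normal vector, all of
  sign vector \<open>\<tau>\<close> and each pair on a supporting hyperplane, are mutually tight. Scale every
  orthant so that the tips of \<open>P\<close> on the axes become unit vectors. The tightness forces each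
  two-dimensional coordinate section to be a rectangle or a triangle, the same in all four quadrants
  because every face is good. Let \<open>i\<close> and \<open>j\<close> be adjacent if their section is triangular. The tightness
  also yields that stable sets give points of \<open>P\<close>, that cliques give valid inequalities, and that
  there is no induced path on four vertices. Hence the graph decomposes by disjoint unions and
  joins, it is perfect, and \<open>P\<close> decomposes accordingly by products and free sums.

  Conversely, the faces of a product or a free sum are determined by faces of the two parts, which
  bounds the number of faces of a generalized Hanner polytope from above.
\<close>

section \<open>Faces of products and free sums\<close>

text \<open>The points of \<open>S\<close> that some point of \<open>T\<close> completes to a point
  of \<open>F\<close> form a face, because a segment through such a point can be translated into the
  sum. An exchange of summands shows that independent choices from \<open>A\<close> and
  \<open>B\<close> stay in \<open>F\<close>.\<close>

lemma face_of_set_plus: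
  assumes conv: "convex S" "convex T" and F: "F face_of {x + y | x y. x \<in> S \<and> y \<in> T}" "F \<noteq> {}"
  shows "\<exists>A B. A face_of S \<and> A \<noteq> {} \<and> B face_of T \<and> B \<noteq> {} \<and> F = {x + y | x y. x \<in> A \<and> y \<in> B}"
proof -
  have slice: "{x \<in> S. \<exists>y\<in>T. x + y \<in> F} face_of S"
    if "convex S" "convex T" "F face_of {x + y | x y. x \<in> S \<and> y \<in> T}" for S T :: "'a set"
    unfolding face_of_def
  proof (intro conjI ballI impI)
    have "convex F"
      using that face_of_imp_convex by blast
    show "convex {x \<in> S. \<exists>y\<in>T. x + y \<in> F}"
    proof (rule convexI)
      fix x x' and u v :: real
      assume "x \<in> {x \<in> S. \<exists>y\<in>T. x + y \<in> F}" "x' \<in> {x \<in> S. \<exists>y\<in>T. x + y \<in> F}" and uv: "0 \<le> u" "0 \<le> v" "u + v = 1"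
      then obtain y y' where *: "x \<in> S" "x' \<in> S" "y \<in> T" "y' \<in> T" "x + y \<in> F" "x' + y' \<in> F"
        by blast
      have "u *\<^sub>R x + v *\<^sub>R x' \<in> S" "u *\<^sub>R y + v *\<^sub>R y' \<in> T" "u *\<^sub>R (x + y) + v *\<^sub>R (x' + y') \<in> F"
        using * uv that \<open>convex F\<close> by (auto intro: convexD)
      moreover have "u *\<^sub>R (x + y) + v *\<^sub>R (x' + y') = (u *\<^sub>R x + v *\<^sub>R x') + (u *\<^sub>R y + v *\<^sub>R y')"
        by (simp add: algebra_simps)
      ultimately show "u *\<^sub>R x + v *\<^sub>R x' \<in> {x \<in> S. \<exists>y\<in>T. x + y \<in> F}"
        by auto
    qed
  next
    fix a b x
    assume *: "a \<in> S" "b \<in> S" "x \<in> {x \<in> S. \<exists>y\<in>T. x + y \<in> F}" "x \<in> open_segment a b"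
    then obtain y where y: "y \<in> T" "x + y \<in> F"
      by blast
    have "x + y \<in> open_segment (a + y) (b + y)"
      using *(4) open_segment_translation[of y a b] by (metis add.commute imageI)
    moreover have "a + y \<in> {x + y | x y. x \<in> S \<and> y \<in> T}" "b + y \<in> {x + y | x y. x \<in> S \<and> y \<in> T}"
      using * y by blast+
    ultimately have "a + y \<in> F \<and> b + y \<in> F"
      using face_ofD[OF that(3)] y by blast
    with * y show "a \<in> {x \<in> S. \<exists>y\<in>T. x + y \<in> F}" "b \<in> {x \<in> S. \<exists>y\<in>T. x + y \<in> F}"
      by blast+
  qed auto
  define A where "A = {x \<in> S. \<exists>y\<in>T. x + y \<in> F}"
  define B where "B = {y \<in> T. \<exists>x\<in>S. y + x \<in> F}"
  have comm: "{x + y | x y. x \<in> T \<and> y \<in> S} = {x + y | x y. x \<in> S \<and> y \<in> T}"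
    by (auto, metis add.commute, metis add.commute)
  have sub: "F \<subseteq> {x + y | x y. x \<in> S \<and> y \<in> T}"
    using F face_of_imp_subset by blast
  have "A face_of S"
    unfolding A_def using conv F by (intro slice)
  moreover have "B face_of T"
    unfolding B_def using conv F comm by (intro slice) auto
  moreover have FAB: "F = {x + y | x y. x \<in> A \<and> y \<in> B}"
  proof
    show "F \<subseteq> {x + y | x y. x \<in> A \<and> y \<in> B}"
    proof
      fix z assume z: "z \<in> F"
      then obtain x y where "z = x + y" "x \<in> S" "y \<in> T"
        using sub by blast
      with z have "x \<in> A" "y \<in> B"
        by (auto simp: A_def B_def add.commute)
      with \<open>z = x + y\<close> show "z \<in> {x + y | x y. x \<in> A \<and> y \<in> B}"
        by blast
    qed
  next
    show "{x + y | x y. x \<in> A \<and> y \<in> B} \<subseteq> F"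
    proof clarify
      fix x y assume "x \<in> A" "y \<in> B"
      then obtain x' y' where *: "x \<in> S" "y' \<in> T" "x + y' \<in> F" "y \<in> T" "x' \<in> S" "y + x' \<in> F"
        by (auto simp: A_def B_def)
      \<comment> \<open>Both pairs have the same total. Their common midpoint lies in
        \<open>F\<close> by convexity, and the face property then pulls in the endpoint
        \<open>x + y\<close>.\<close>
      have mid: "midpoint (x + y) (x' + y') = midpoint (x + y') (y + x')"
        by (simp add: midpoint_def algebra_simps)
      have "midpoint (x + y') (y + x') \<in> F"
        using closed_segment_subset[OF *(3,6) face_of_imp_convex[OF F(1)]] midpoint_in_closed_segment by blast
      show "x + y \<in> F"
      proof (cases "x + y = x' + y'")
        case True
        then show ?thesis
          using mid \<open>midpoint (x + y') (y + x') \<in> F\<close> by simp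
      next
        case False
        then have "midpoint (x + y') (y + x') \<in> open_segment (x + y) (x' + y')"
          unfolding mid[symmetric] by simp
        moreover have "x + y \<in> {x + y | x y. x \<in> S \<and> y \<in> T}" "x' + y' \<in> {x + y | x y. x \<in> S \<and> y \<in> T}"
          using * by blast+
        ultimately show ?thesis
          using face_ofD[OF F(1)] \<open>midpoint (x + y') (y + x') \<in> F\<close> by blast
      qed
    qed
  qed
  moreover have "A \<noteq> {}" "B \<noteq> {}"
    using FAB F(2) by auto
  ultimately show ?thesis by blast
qed

text \<open>A point of \<open>F\<close> lies on a segment from \<open>S\<close> to \<open>T\<close>;
  if it is strictly between the endpoints, the face property puts both endpoints in
  \<open>F\<close>.\<close>

lemma face_of_convex_hull_Un:
  fixes S T :: "'a::euclidean_space set"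
  assumes "convex S" "convex T" "S \<noteq> {}" "T \<noteq> {}" and F: "F face_of convex hull (S \<union> T)"
  shows "F = convex hull ((F \<inter> S) \<union> (F \<inter> T))"
proof
  have "convex F"
    using F face_of_imp_convex by blast
  then show "convex hull ((F \<inter> S) \<union> (F \<inter> T)) \<subseteq> F"
    by (intro hull_minimal) auto
  show "F \<subseteq> convex hull ((F \<inter> S) \<union> (F \<inter> T))"
  proof
    fix z assume z: "z \<in> F"
    then have "z \<in> convex hull (S \<union> T)"
      using F face_of_imp_subset by blast
    then obtain u v x y where *: "z = u *\<^sub>R x + v *\<^sub>R y" "0 \<le> u" "0 \<le> v" "u + v = 1" "x \<in> S" "y \<in> T"
      using convex_hull_union_two[OF assms(1,3,2,4)] by auto
    have xy: "x \<in> convex hull (S \<union> T)" "y \<in> convex hull (S \<union> T)"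
      using * by (auto intro: hull_inc)
    consider "u = 0" | "v = 0" | "x = y" | "u > 0" "v > 0" "x \<noteq> y"
      using * by fastforce
    then show "z \<in> convex hull ((F \<inter> S) \<union> (F \<inter> T))"
    proof cases
      case 4
      have "z = (1 - v) *\<^sub>R x + v *\<^sub>R y"
        using * by (metis add_diff_cancel_right')
      then have "z \<in> open_segment x y"
        unfolding in_segment using 4 * by (intro conjI exI[of _ v]) auto
      then have "x \<in> F" "y \<in> F"
        using face_ofD[OF F] xy z by blast+
      then have "x \<in> convex hull ((F \<inter> S) \<union> (F \<inter> T))" "y \<in> convex hull ((F \<inter> S) \<union> (F \<inter> T))"
        using * by (auto intro: hull_inc)
      then show ?thesis
        unfolding *(1) using * by (intro convexD[OF convex_convex_hull]) auto
    next
      case 3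
      then have "z = x"
        using * by (metis scaleR_add_left scaleR_one)
      then show ?thesis
        using z * by (auto intro: hull_inc)
    qed (use * z in \<open>auto intro: hull_inc\<close>)
  qed
qed

text \<open>By the last hypothesis every nonzero point of \<open>P\<close> is an endpoint of a
  segment with ends in \<open>P\<close> that has the origin strictly inside, so the face property
  applies.\<close>

lemma face_of_zero_eq:
  assumes F: "F face_of P" and "0 \<in> F" and "\<And>x. x \<in> P \<Longrightarrow> \<exists>e>0. - (e *\<^sub>R x) \<in> P"
  shows "F = P"
proof
  show "F \<subseteq> P"
    using F face_of_imp_subset by blast
  show "P \<subseteq> F"
  proof
    fix x assume x: "x \<in> P"
    then obtain e where e: "e > 0" "- (e *\<^sub>R x) \<in> P"
      using assms(3) by blast
    show "x \<in> F"
    proof (cases "x = 0")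
      case False
      have "x \<noteq> - (e *\<^sub>R x)"
      proof
        assume "x = - (e *\<^sub>R x)"
        then have "x + e *\<^sub>R x = 0"
          by (metis add.left_inverse)
        then have "(1 + e) *\<^sub>R x = 0"
          by (simp add: scaleR_add_left)
        with e False show False by simp
      qed
      moreover have "0 = (1 - 1 / (1 + e)) *\<^sub>R x + (1 / (1 + e)) *\<^sub>R - (e *\<^sub>R x)"
      proof -
        have "(1 - 1 / (1 + e)) = e / (1 + e)"
          using e by (simp add: field_simps)
        then show ?thesis by simp
      qed
      ultimately have "0 \<in> open_segment x (- (e *\<^sub>R x))"
        unfolding in_segment using e by (intro conjI exI[of _ "1 / (1 + e)"]) auto
      then show ?thesis
        using face_ofD[OF F] x e assms(2) by blast
    qed (use assms in auto)
  qed
qed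

lemma card_faces_set_plus_le:
  fixes S T :: "'a::real_vector set"
  assumes "convex S" "convex T" "finite {F. F face_of S \<and> F \<noteq> {}}" "finite {F. F face_of T \<and> F \<noteq> {}}"
  shows "finite {F. F face_of {x + y | x y. x \<in> S \<and> y \<in> T} \<and> F \<noteq> {}} \<and>
    card {F. F face_of {x + y | x y. x \<in> S \<and> y \<in> T} \<and> F \<noteq> {}} \<le>
      card {F. F face_of S \<and> F \<noteq> {}} * card {F. F face_of T \<and> F \<noteq> {}}"
proof -
  let ?C = "{F. F face_of S \<and> F \<noteq> {}} \<times> {F. F face_of T \<and> F \<noteq> {}}"
  have sub: "{F. F face_of {x + y | x y. x \<in> S \<and> y \<in> T} \<and> F \<noteq> {}} \<subseteq> (\<lambda>(A, B). {x + y | x y. x \<in> A \<and> y \<in> B}) ` ?C"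
  proof
    fix F assume "F \<in> {F. F face_of {x + y | x y. x \<in> S \<and> y \<in> T} \<and> F \<noteq> {}}"
    then obtain A B where "(A, B) \<in> ?C" "F = {x + y | x y. x \<in> A \<and> y \<in> B}"
      using face_of_set_plus[OF assms(1,2), of F] by auto
    then show "F \<in> (\<lambda>(A, B). {x + y | x y. x \<in> A \<and> y \<in> B}) ` ?C"
      by (metis (no_types, lifting) case_prod_conv image_eqI)
  qed
  have fin: "finite ?C"
    using assms by simp
  show ?thesis
    using card_mono[OF finite_imageI[OF fin] sub] card_image_le[OF fin, of "\<lambda>(A, B). {x + y | x y. x \<in> A \<and> y \<in> B}"]
      finite_subset[OF sub finite_imageI[OF fin]] by (simp add: card_cartesian_product)
qed

text \<open>A face containing the origin is the whole hull. Any other nonempty face is spanned by a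
  face of \<open>S\<close> and a face of \<open>T\<close>, neither of them the full part and not
  both empty. This gives the product minus one, plus one for the hull itself.\<close>

lemma card_faces_convex_hull_Un_le:
  fixes S T :: "'a::euclidean_space set"
  assumes conv: "convex S" "convex T" and zero: "0 \<in> S" "0 \<in> T"
    and fin: "finite {F. F face_of S \<and> F \<noteq> {}}" "finite {F. F face_of T \<and> F \<noteq> {}}"
    and abs: "\<And>x. x \<in> convex hull (S \<union> T) \<Longrightarrow> \<exists>e>0. - (e *\<^sub>R x) \<in> convex hull (S \<union> T)"
  shows "finite {F. F face_of convex hull (S \<union> T) \<and> F \<noteq> {}} \<and>
    card {F. F face_of convex hull (S \<union> T) \<and> F \<noteq> {}} \<le>
      card {F. F face_of S \<and> F \<noteq> {}} * card {F. F face_of T \<and> F \<noteq> {}}"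
proof -
  let ?P = "convex hull (S \<union> T)"
  let ?f = "\<lambda>(A, B). convex hull (A \<union> B)"
  \<comment> \<open>Exchanging \<open>U\<close> with the empty face shows that there are as many
    faces other than \<open>U\<close> as nonempty ones.\<close>
  have proper: "finite {F. F face_of U \<and> F \<noteq> U} \<and> card {F. F face_of U \<and> F \<noteq> U} = card {F. F face_of U \<and> F \<noteq> {}}"
    if U: "convex U" "0 \<in> U" "finite {F. F face_of U \<and> F \<noteq> {}}" for U :: "'a set"
  proof -
    have "bij_betw (\<lambda>F. if F = U then {} else F) {F. F face_of U \<and> F \<noteq> {}} {F. F face_of U \<and> F \<noteq> U}"
      using U by (intro bij_betw_byWitness[where f' = "\<lambda>F. if F = {} then U else F"]) (auto simp: face_of_refl)
    from bij_betw_finite[OF this] bij_betw_same_card[OF this] show ?thesis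
      using U(3) by simp
  qed
  let ?D = "{F. F face_of S \<and> F \<noteq> S} \<times> {F. F face_of T \<and> F \<noteq> T} - {({}, {})}"
  have sub: "{F. F face_of ?P \<and> F \<noteq> {}} \<subseteq> insert ?P (?f ` ?D)"
  proof
    fix F assume "F \<in> {F. F face_of ?P \<and> F \<noteq> {}}"
    then have F: "F face_of ?P" "F \<noteq> {}" by auto
    have eq: "F = convex hull ((F \<inter> S) \<union> (F \<inter> T))"
      using face_of_convex_hull_Un[OF conv _ _ F(1)] zero by blast
    have ST: "S \<subseteq> ?P" "T \<subseteq> ?P"
      by (auto intro: hull_inc)
    show "F \<in> insert ?P (?f ` ?D)"
    proof (cases "0 \<in> F")
      case True
      then show ?thesis
        using face_of_zero_eq[OF F(1) True] abs by blast
    next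
      case False
      have "(F \<inter> S) face_of S" "(F \<inter> T) face_of T"
        using face_of_slice[OF F(1)] conv ST by (metis Int_absorb1)+
      moreover have "F \<inter> S \<noteq> S" "F \<inter> T \<noteq> T"
        using False zero by auto
      moreover have "(F \<inter> S, F \<inter> T) \<noteq> ({}, {})"
        using F(2) eq by auto
      ultimately have "(F \<inter> S, F \<inter> T) \<in> ?D"
        by simp
      then have "?f (F \<inter> S, F \<inter> T) \<in> ?f ` ?D"
        by (rule imageI)
      then show ?thesis
        using eq by simp
    qed
  qed
  have finD: "finite ?D"
    using proper[OF conv(1) zero(1) fin(1)] proper[OF conv(2) zero(2) fin(2)] by simp
  have "({}, {}) \<in> {F. F face_of S \<and> F \<noteq> S} \<times> {F. F face_of T \<and> F \<noteq> T}"
    using zero by auto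
  then have "Suc (card ?D) = card ({F. F face_of S \<and> F \<noteq> S} \<times> {F. F face_of T \<and> F \<noteq> T})"
    using proper[OF conv(1) zero(1) fin(1)] proper[OF conv(2) zero(2) fin(2)]
    by (intro card_Suc_Diff1) auto
  also have "\<dots> = card {F. F face_of S \<and> F \<noteq> {}} * card {F. F face_of T \<and> F \<noteq> {}}"
    using proper[OF conv(1) zero(1) fin(1)] proper[OF conv(2) zero(2) fin(2)] by (simp add: card_cartesian_product)
  finally have card_D: "Suc (card ?D) = \<dots>" .
  have "card {F. F face_of ?P \<and> F \<noteq> {}} \<le> card (insert ?P (?f ` ?D))"
    using finD by (intro card_mono[OF _ sub]) simp
  also have "\<dots> \<le> Suc (card (?f ` ?D))"
    by (rule card_insert_le_m1) auto
  also have "\<dots> \<le> Suc (card ?D)"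
    using card_image_le[OF finD, of ?f] by simp
  finally show ?thesis
    using finite_subset[OF sub] finD card_D by simp
qed

section \<open>Face count of generalized Hanner polytopes\<close>

lemma hanner_convex_zero_absorbing:
  assumes "generalized_hanner_on J P"
  shows "convex P \<and> 0 \<in> P \<and> (\<forall>x\<in>P. \<exists>e>0. - (e *\<^sub>R x) \<in> P)"
  using assms
proof (induction rule: generalized_hanner_on.induct)
  case (segment a b i)
  let ?P = "closed_segment (axis i a) (axis i b) :: (real ^ 'a) set"
  have P: "x \<in> ?P \<longleftrightarrow> (\<exists>t. a \<le> t \<and> t \<le> b \<and> x = axis i t)" for x
  proof -
    have "linear (axis i :: real \<Rightarrow> real ^ 'a)"
      by (rule linearI) (simp_all add: vec_eq_iff axis_def)
    then have "?P = axis i ` closed_segment a b"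
      by (rule closed_segment_linear_image)
    then show ?thesis
      using segment by (auto simp: closed_segment_eq_real_ivl)
  qed
  have "\<exists>e>0. - (e *\<^sub>R x) \<in> ?P" if x: "x \<in> ?P" for x
  proof -
    obtain t where t: "a \<le> t" "t \<le> b" "x = axis i t"
      using x P by blast
    \<comment> \<open>This ratio brings every \<open>t\<close> in the interval down to modulus at
      most \<open>min (- a) b\<close>, so \<open>- (e * t)\<close> is in the interval again.\<close>
    define e where "e = min (- a) b / max (- a) b"
    have m: "0 < min (- a) b" "0 < max (- a) b"
      using segment by auto
    have "\<bar>e * t\<bar> \<le> min (- a) b"
    proof -
      have "\<bar>e * t\<bar> \<le> e * max (- a) b"
        unfolding abs_mult using t m by (intro mult_mono) (auto simp: e_def)
      then show ?thesis
        using m by (simp add: e_def)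
    qed
    then have "a \<le> - (e * t)" "- (e * t) \<le> b"
      by auto
    moreover have "- (e *\<^sub>R x) = axis i (- (e * t))"
      using t by (simp add: vec_eq_iff axis_def)
    ultimately have "- (e *\<^sub>R x) \<in> ?P"
      using P by blast
    moreover have "e > 0"
      using m by (simp add: e_def)
    ultimately show ?thesis by blast
  qed
  moreover have "0 \<in> ?P"
    unfolding P using segment by (intro exI[of _ 0]) (auto simp: vec_eq_iff axis_def)
  ultimately show ?case by simp
next
  case (product J\<^sub>1 P\<^sub>1 J\<^sub>2 P\<^sub>2)
  then have c: "convex P\<^sub>1" "convex P\<^sub>2" and z: "0 \<in> P\<^sub>1" "0 \<in> P\<^sub>2" by auto
  \<comment> \<open>A factor may be decreased because the origin is in the set; hence both summands
    can use the smaller of their two factors.\<close>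
  have scale: "- (f *\<^sub>R x) \<in> P" if "convex P" "0 \<in> P" "- (e *\<^sub>R x) \<in> P" "0 < f" "f \<le> e" for P x and e f :: real
  proof -
    have "(f / e) *\<^sub>R - (e *\<^sub>R x) + (1 - f / e) *\<^sub>R 0 \<in> P"
      using that by (intro convexD[OF that(1)]) (auto simp: field_simps)
    then show ?thesis
      using that by simp
  qed
  have "\<exists>e>0. - (e *\<^sub>R (x + y)) \<in> {x + y | x y. x \<in> P\<^sub>1 \<and> y \<in> P\<^sub>2}" if xy: "x \<in> P\<^sub>1" "y \<in> P\<^sub>2" for x y
  proof -
    obtain e where e: "e > 0" "- (e *\<^sub>R x) \<in> P\<^sub>1"
      using product.IH(1) xy(1) by blast
    obtain f where f: "f > 0" "- (f *\<^sub>R y) \<in> P\<^sub>2"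
      using product.IH(2) xy(2) by blast
    have "- (min e f *\<^sub>R x) \<in> P\<^sub>1" "- (min e f *\<^sub>R y) \<in> P\<^sub>2" "min e f > 0"
      using scale[OF c(1) z(1) e(2), of "min e f"] scale[OF c(2) z(2) f(2), of "min e f"] e(1) f(1) by simp_all
    moreover have "- (min e f *\<^sub>R (x + y)) = - (min e f *\<^sub>R x) + - (min e f *\<^sub>R y)"
      by (simp add: scaleR_add_right)
    ultimately show ?thesis
      by (intro exI[of _ "min e f"]) blast
  qed
  then have "\<forall>x\<in>{x + y | x y. x \<in> P\<^sub>1 \<and> y \<in> P\<^sub>2}. \<exists>e>0. - (e *\<^sub>R x) \<in> {x + y | x y. x \<in> P\<^sub>1 \<and> y \<in> P\<^sub>2}"
    by blast
  moreover have "convex {x + y | x y. x \<in> P\<^sub>1 \<and> y \<in> P\<^sub>2}"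
  proof -
    have "{x + y | x y. x \<in> P\<^sub>1 \<and> y \<in> P\<^sub>2} = (\<Union>x\<in>P\<^sub>1. \<Union>y\<in>P\<^sub>2. {x + y})"
      by blast
    then show ?thesis
      using convex_sums[OF c] by simp
  qed
  moreover have "0 \<in> {x + y | x y. x \<in> P\<^sub>1 \<and> y \<in> P\<^sub>2}"
    using z by force
  ultimately show ?case by simp
next
  case (free_sum J\<^sub>1 P\<^sub>1 J\<^sub>2 P\<^sub>2)
  let ?P = "convex hull (P\<^sub>1 \<union> P\<^sub>2)"
  \<comment> \<open>The points absorbed by the hull form a convex set that contains both parts,
    hence the whole hull.\<close>
  define A where "A = {x. \<exists>e>0. - (e *\<^sub>R x) \<in> ?P}"
  have zP: "0 \<in> ?P"
    using free_sum by (auto intro: hull_inc)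
  have scale: "- (f *\<^sub>R x) \<in> ?P" if "- (e *\<^sub>R x) \<in> ?P" "0 < f" "f \<le> e" for x and e f :: real
  proof -
    have "(f / e) *\<^sub>R - (e *\<^sub>R x) + (1 - f / e) *\<^sub>R 0 \<in> ?P"
      using that zP by (intro convexD[OF convex_convex_hull]) (auto simp: field_simps)
    then show ?thesis
      using that by simp
  qed
  have "convex A"
  proof (rule convexI)
    fix x y and u v :: real
    assume "x \<in> A" "y \<in> A" and uv: "0 \<le> u" "0 \<le> v" "u + v = 1"
    then obtain e f where e: "e > 0" "- (e *\<^sub>R x) \<in> ?P" and f: "f > 0" "- (f *\<^sub>R y) \<in> ?P"
      by (auto simp: A_def)
    have *: "- (min e f *\<^sub>R x) \<in> ?P" "- (min e f *\<^sub>R y) \<in> ?P" "min e f > 0"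
      using scale[OF e(2), of "min e f"] scale[OF f(2), of "min e f"] e(1) f(1) by simp_all
    then have "u *\<^sub>R - (min e f *\<^sub>R x) + v *\<^sub>R - (min e f *\<^sub>R y) \<in> ?P"
      using uv by (intro convexD[OF convex_convex_hull])
    moreover have "u *\<^sub>R - (min e f *\<^sub>R x) + v *\<^sub>R - (min e f *\<^sub>R y) = - (min e f *\<^sub>R (u *\<^sub>R x + v *\<^sub>R y))"
      by (simp add: algebra_simps)
    ultimately show "u *\<^sub>R x + v *\<^sub>R y \<in> A"
      using *(3) unfolding A_def by (intro CollectI exI[of _ "min e f"]) metis
  qed
  moreover have "P\<^sub>1 \<union> P\<^sub>2 \<subseteq> A"
  proof
    fix x assume "x \<in> P\<^sub>1 \<union> P\<^sub>2"
    then obtain e where e: "e > 0" "- (e *\<^sub>R x) \<in> P\<^sub>1 \<union> P\<^sub>2"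
      using free_sum.IH by blast
    from hull_inc[OF e(2)] e(1) show "x \<in> A"
      unfolding A_def by blast
  qed
  ultimately have "?P \<subseteq> A"
    by (rule hull_minimal[rotated])
  with zP show ?case
    by (auto simp: A_def)
qed

lemma face_of_closed_segment:
  assumes F: "F face_of closed_segment a b" and "F \<noteq> {}"
  shows "F = {a} \<or> F = {b} \<or> F = closed_segment a b"
proof -
  have sub: "F \<subseteq> closed_segment a b" and conv: "convex F"
    using F face_of_imp_subset face_of_imp_convex by auto
  show ?thesis
  proof (cases "a \<in> F \<and> b \<in> F")
    case True
    then have "closed_segment a b \<subseteq> F"
      using conv by (simp add: closed_segment_subset)
    with sub show ?thesis by blast
  next
    case False
    then have "F \<inter> open_segment a b = {}"
      using face_ofD[OF F, of _ a b] by auto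
    then have "F \<subseteq> {a, b}"
      using sub by (auto simp: open_segment_def)
    with False \<open>F \<noteq> {}\<close> show ?thesis by blast
  qed
qed

lemma card_faces_hanner_le:
  assumes "generalized_hanner_on J P"
  shows "finite {F. F face_of P \<and> F \<noteq> {}} \<and> card {F. F face_of P \<and> F \<noteq> {}} \<le> 3 ^ card J"
  using assms
proof (induction rule: generalized_hanner_on.induct)
  case (segment a b i)
  have "{F. F face_of closed_segment (axis i a) (axis i b) \<and> F \<noteq> {}} \<subseteq>
      {{axis i a}, {axis i b :: real ^ 'a}, closed_segment (axis i a) (axis i b)}"
    using face_of_closed_segment by blast
  moreover have "finite {{axis i a}, {axis i b :: real ^ 'a}, closed_segment (axis i a) (axis i b)}"
    by simp
  moreover have "card {{axis i a}, {axis i b :: real ^ 'a}, closed_segment (axis i a) (axis i b)} \<le> 3"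
    by (simp add: card_insert_if)
  ultimately show ?case
    using card_mono finite_subset order_trans by (metis (no_types, lifting) card_1_singleton_iff One_nat_def power_one_right)
next
  case (product J\<^sub>1 P\<^sub>1 J\<^sub>2 P\<^sub>2)
  have "finite J\<^sub>1" "finite J\<^sub>2" by auto
  then have "card (J\<^sub>1 \<union> J\<^sub>2) = card J\<^sub>1 + card J\<^sub>2"
    using product.hyps by (simp add: card_Un_disjoint)
  then have "card {F. F face_of P\<^sub>1 \<and> F \<noteq> {}} * card {F. F face_of P\<^sub>2 \<and> F \<noteq> {}} \<le> 3 ^ card (J\<^sub>1 \<union> J\<^sub>2)"
    using product.IH by (simp add: power_add mult_mono)
  then show ?case
    using card_faces_set_plus_le[of P\<^sub>1 P\<^sub>2] product hanner_convex_zero_absorbing by fastforce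
next
  case (free_sum J\<^sub>1 P\<^sub>1 J\<^sub>2 P\<^sub>2)
  have "finite J\<^sub>1" "finite J\<^sub>2" by auto
  then have "card (J\<^sub>1 \<union> J\<^sub>2) = card J\<^sub>1 + card J\<^sub>2"
    using free_sum.hyps by (simp add: card_Un_disjoint)
  then have "card {F. F face_of P\<^sub>1 \<and> F \<noteq> {}} * card {F. F face_of P\<^sub>2 \<and> F \<noteq> {}} \<le> 3 ^ card (J\<^sub>1 \<union> J\<^sub>2)"
    using free_sum.IH by (simp add: power_add mult_mono)
  moreover note hanner_convex_zero_absorbing[OF free_sum.hyps(1)] hanner_convex_zero_absorbing[OF free_sum.hyps(2)]
    hanner_convex_zero_absorbing[OF generalized_hanner_on.free_sum[OF free_sum.hyps]]
  ultimately show ?case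
    using card_faces_convex_hull_Un_le[of P\<^sub>1 P\<^sub>2] free_sum.IH by fastforce
qed

section \<open>Good faces and the lower bound\<close>

text \<open>A minimal face through \<open>x\<close> works: if \<open>x\<close> were on its relative
  boundary, one of its facets would be a smaller face through \<open>x\<close>.\<close>

lemma polytope_ex_face_rel_interior:
  fixes S :: "'a::euclidean_space set"
  assumes "polytope S" "x \<in> S"
  obtains F where "F face_of S" "x \<in> rel_interior F"
proof -
  have "finite {F. F face_of S \<and> x \<in> F}"
    using finite_polytope_faces[OF assms(1)] by (rule rev_finite_subset) auto
  moreover have "S \<in> {F. F face_of S \<and> x \<in> F}"
    using assms by (simp add: face_of_refl polytope_imp_convex)
  ultimately obtain F where F: "F face_of S" "x \<in> F"
    and min: "\<And>G. G face_of S \<Longrightarrow> x \<in> G \<Longrightarrow> G \<subseteq> F \<Longrightarrow> G = F"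
    using finite_has_minimal[of "{F. F face_of S \<and> x \<in> F}"] by auto
  have "x \<in> rel_interior F"
  proof (rule ccontr)
    assume "x \<notin> rel_interior F"
    moreover have "polyhedron F"
      using F assms(1) face_of_polytope_polytope polytope_imp_polyhedron by blast
    ultimately obtain G where G: "G facet_of F" "x \<in> G"
      using rel_boundary_of_polyhedron[of F] F(2) by blast
    then have "G = F"
      using F min face_of_trans facet_of_imp_face_of facet_of_imp_subset by metis
    then show False
      using G(1) by (simp add: facet_of_def)
  qed
  with F that show ?thesis by blast
qed

lemma rel_interior_prolong:
  fixes x y :: "'a::euclidean_space"
  assumes "convex S" "x \<in> rel_interior S" "y \<in> S"
  obtains e where "e > 0" "x + e *\<^sub>R (x - y) \<in> S"
proof -
  obtain e where "e > 1" "(1 - e) *\<^sub>R y + e *\<^sub>R x \<in> S"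
    using convex_rel_interior_iff[OF assms(1), of x] assms by blast
  moreover have "(1 - e) *\<^sub>R y + e *\<^sub>R x = x + (e - 1) *\<^sub>R (x - y)"
    by (simp add: algebra_simps)
  ultimately show ?thesis
    using that[of "e - 1"] by simp
qed

definition sign_vectors :: "('n \<Rightarrow> real) set" where
  "sign_vectors = {\<tau>. \<forall>i. \<tau> i \<in> {-1, 0, 1}}"

lemma card_sign_vectors: "card (sign_vectors :: ('n::finite \<Rightarrow> real) set) = 3 ^ CARD('n)"
proof -
  have eq: "sign_vectors = PiE (UNIV :: 'n set) (\<lambda>_. {-1, 0, 1 :: real})"
    by (auto simp: sign_vectors_def PiE_def Pi_def extensional_def)
  show ?thesis
    unfolding eq by (subst card_PiE) (auto simp: numeral_3_eq_3)
qed

text \<open>At \<open>t = 0\<close> the product is 1 and its derivative is the sum of the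
  \<open>r i\<close>; a positive derivative would push it above 1. This is the first-order condition
  at a maximizer of a product.\<close>

lemma prod_le_imp_sum_nonpos:
  fixes r :: "'a \<Rightarrow> real"
  assumes "finite I" and le: "\<And>t. 0 < t \<Longrightarrow> t \<le> 1 \<Longrightarrow> (\<Prod>i\<in>I. 1 + t * r i) \<le> 1"
  shows "(\<Sum>i\<in>I. r i) \<le> 0"
proof (rule ccontr)
  assume "\<not> ?thesis"
  then have pos: "0 < (\<Sum>i\<in>I. r i)" by simp
  have "((\<lambda>t. \<Prod>i\<in>I. 1 + t * r i) has_real_derivative (\<Sum>i\<in>I. r i * (\<Prod>j\<in>I - {i}. 1 + 0 * r j))) (at 0)"
    by (rule has_field_derivative_prod) (auto intro!: derivative_eq_intros)
  then obtain d where d: "d > 0" "\<And>h. 0 < h \<Longrightarrow> h < d \<Longrightarrow> (\<Prod>i\<in>I. 1 + 0 * r i) < (\<Prod>i\<in>I. 1 + (0 + h) * r i)"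
    using DERIV_pos_inc_right[of "\<lambda>t. \<Prod>i\<in>I. 1 + t * r i" _ 0] pos by auto
  show False
    using d(2)[of "min 1 (d / 2)"] le[of "min 1 (d / 2)"] d(1) by (auto simp: min_less_iff_disj)
qed

section \<open>Good pairs and good faces of a locally anti-blocking polytope\<close>

locale lab_polytope =
  fixes P :: "(real ^ 'n::finite) set"
  assumes polytope_P: "polytope P"
    and lab_P: "locally_anti_blocking P"
    and zero_interior: "0 \<in> interior P"
begin

lemma convex_P: "convex P"
  by (simp add: polytope_P polytope_imp_convex)

lemma compact_P: "compact P"
  by (simp add: polytope_P polytope_imp_compact)

lemma proj_P: "x \<in> P \<Longrightarrow> coord_proj J x \<in> P"
  using lab_P by (simp add: locally_anti_blocking_def)

lemma zero_P: "0 \<in> P"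
  using zero_interior interior_subset by blast

text \<open>Setting coordinate \<open>i\<close> to 0 keeps \<open>u\<close> in \<open>P\<close> and
  subtracts \<open>a $ i * u $ i\<close> from the maximal value.\<close>

lemma maximizer_sign:
  assumes "\<And>y. y \<in> P \<Longrightarrow> a \<bullet> y \<le> m" "u \<in> P" "a \<bullet> u = m"
  shows "a $ i * u $ i \<ge> 0"
proof -
  have "a \<bullet> coord_proj (- {i}) u = a \<bullet> u - a $ i * u $ i"
  proof -
    have "coord_proj (- {i}) u = u - axis i (u $ i)"
      by (simp add: coord_proj_def vec_eq_iff axis_def)
    then show ?thesis
      by (simp add: inner_diff_right inner_axis)
  qed
  with assms(1)[OF proj_P[OF assms(2), of "- {i}"]] assms(3) show ?thesis by simp
qed

text \<open>The normal vector may vanish: for the zero sign vector the pair is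
  \<open>(0, 0)\<close>, and its face is all of \<open>P\<close>.\<close>

definition good_pair :: "('n \<Rightarrow> real) \<Rightarrow> real ^ 'n \<Rightarrow> real ^ 'n \<Rightarrow> bool" where
  "good_pair \<tau> x a \<longleftrightarrow> x \<in> P \<and> (\<forall>y\<in>P. a \<bullet> y \<le> a \<bullet> x) \<and> (\<forall>i. sgn (x $ i) = \<tau> i) \<and> (\<forall>i. sgn (a $ i) = \<tau> i)"

definition good_face :: "('n \<Rightarrow> real) \<Rightarrow> (real ^ 'n) set \<Rightarrow> bool" where
  "good_face \<tau> F \<longleftrightarrow> F face_of P \<and> (\<exists>x a. x \<in> rel_interior F \<and> good_pair \<tau> x a)"

text \<open>A value at \<open>y\<close> below the maximum would give a value above it on the
  prolongation of the segment from \<open>y\<close> beyond the relative interior point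
  \<open>x\<close>.\<close>

lemma good_pair_const_on_face:
  assumes "F face_of P" "x \<in> rel_interior F" "good_pair \<tau> x a" "y \<in> F"
  shows "a \<bullet> y = a \<bullet> x"
proof -
  obtain e where e: "e > 0" "x + e *\<^sub>R (x - y) \<in> F"
    using rel_interior_prolong assms face_of_imp_convex by metis
  then have "a \<bullet> (x + e *\<^sub>R (x - y)) \<le> a \<bullet> x"
    using assms face_of_imp_subset by (metis good_pair_def subsetD)
  then have "e * (a \<bullet> x - a \<bullet> y) \<le> 0"
    by (simp add: inner_add_right inner_diff_right)
  then have "a \<bullet> x \<le> a \<bullet> y"
    using e(1) by (simp add: mult_le_0_iff)
  moreover have "a \<bullet> y \<le> a \<bullet> x"
    using assms face_of_imp_subset by (metis good_pair_def subsetD)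
  ultimately show ?thesis by simp
qed

text \<open>Prolonging from \<open>x\<close> beyond \<open>z\<close> gives a point \<open>u\<close>
  of \<open>F\<close> that still maximizes \<open>a\<close>, so \<open>a $ i * u $ i\<close> is
  nonnegative. As \<open>z\<close> mixes \<open>x\<close> and \<open>u\<close> with positive weights
  and \<open>a $ i * x $ i\<close> is positive, so is \<open>a $ i * z $ i\<close>. Applied in both
  directions, this makes the sign vector of a good face unique.\<close>

lemma good_pair_sign_le:
  assumes F: "F face_of P" and x: "x \<in> rel_interior F" "good_pair \<tau> x a" and z: "z \<in> rel_interior F" and i: "\<tau> i \<noteq> 0"
  shows "sgn (z $ i) = \<tau> i"
proof -
  have xF: "x \<in> F"
    using x rel_interior_subset by blast
  obtain e where e: "e > 0" "z + e *\<^sub>R (z - x) \<in> F"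
    using rel_interior_prolong[OF face_of_imp_convex[OF F] z xF] .
  define u where "u = z + e *\<^sub>R (z - x)"
  have sg: "sgn (x $ i) = \<tau> i" "sgn (a $ i) = \<tau> i"
    using x(2) by (auto simp: good_pair_def)
  have "a $ i * u $ i \<ge> 0"
  proof (rule maximizer_sign)
    show "a \<bullet> y \<le> a \<bullet> x" if "y \<in> P" for y
      using x(2) that by (simp add: good_pair_def)
    show "u \<in> P"
      using e F face_of_imp_subset u_def by blast
    show "a \<bullet> u = a \<bullet> x"
      using good_pair_const_on_face[OF F x] e by (simp add: u_def)
  qed
  moreover have "a $ i * u $ i = (1 + e) * (a $ i * z $ i) - e * (a $ i * x $ i)"
    by (simp add: u_def algebra_simps)
  moreover have "a $ i * x $ i > 0"
    using sg i by (auto simp: sgn_real_def zero_less_mult_iff split: if_splits)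
  then have "e * (a $ i * x $ i) > 0"
    using e(1) by simp
  ultimately have "(1 + e) * (a $ i * z $ i) > 0"
    by linarith
  then have "a $ i * z $ i > 0"
    using e(1) by (simp add: zero_less_mult_iff)
  then show ?thesis
    using sg(2) by (metis sgn_neg sgn_pos zero_less_mult_iff)
qed

lemma good_face_unique_sign:
  assumes "good_face \<tau> F" "good_face \<tau>' F"
  shows "\<tau> = \<tau>'"
proof
  fix i
  obtain x a x' a' where *: "F face_of P" "x \<in> rel_interior F" "good_pair \<tau> x a" "x' \<in> rel_interior F" "good_pair \<tau>' x' a'"
    using assms by (auto simp: good_face_def)
  have "sgn (x $ i) = \<tau> i" "sgn (x' $ i) = \<tau>' i"
    using * by (auto simp: good_pair_def)
  then show "\<tau> i = \<tau>' i"
    using good_pair_sign_le[OF *(1,2,3,4), of i] good_pair_sign_le[OF *(1,4,5,2), of i] by (cases "\<tau> i = 0"; cases "\<tau>' i = 0") auto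
qed

lemma good_pair_face:
  assumes "good_pair \<tau> x a"
  obtains F where "good_face \<tau> F" "F face_of P" "x \<in> rel_interior F"
  using polytope_ex_face_rel_interior[OF polytope_P, of x] assms unfolding good_face_def good_pair_def by metis

text \<open>The maximizer of the product of the coordinates prescribed by \<open>\<tau>\<close>, with the gradient of the
  logarithm of that product, is a good pair. The coordinates outside the support are handled by
  \<open>inverse 0 = 0\<close>.\<close>

lemma ex_good_pair:
  assumes "\<tau> \<in> sign_vectors"
  shows "\<exists>x a. good_pair \<tau> x a"
proof -
  define I where "I = {i. \<tau> i \<noteq> 0}"
  have \<tau>: "\<tau> i = 1 \<or> \<tau> i = -1" if "i \<in> I" for i
    using assms that by (auto simp: I_def sign_vectors_def)
  define C where "C = {x \<in> P. \<forall>i. \<tau> i * x $ i \<ge> 0 \<and> (i \<notin> I \<longrightarrow> x $ i = 0)}"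
  define f where "f x = (\<Prod>i\<in>I. \<tau> i * x $ i)" for x :: "real ^ 'n"
  have "closed {x :: real ^ 'n. \<forall>i. \<tau> i * x $ i \<ge> 0 \<and> (i \<notin> I \<longrightarrow> x $ i = 0)}"
    by (intro closed_Collect_all closed_Collect_conj closed_Collect_imp closed_Collect_le closed_Collect_eq)
      (auto intro!: continuous_intros)
  moreover have "C = P \<inter> {x :: real ^ 'n. \<forall>i. \<tau> i * x $ i \<ge> 0 \<and> (i \<notin> I \<longrightarrow> x $ i = 0)}"
    by (auto simp: C_def)
  ultimately have "compact C"
    using compact_Int_closed[OF compact_P] by simp
  moreover have "0 \<in> C"
    by (simp add: C_def zero_P)
  moreover have "continuous_on C f"
    unfolding f_def by (intro continuous_intros)
  ultimately obtain x where x: "x \<in> C" and xmax: "\<And>y. y \<in> C \<Longrightarrow> f y \<le> f x"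
    using continuous_attains_sup[of C f] by blast
  have "f x > 0"
  proof -
    \<comment> \<open>A small multiple of the sign vector itself lies in \<open>C\<close>, as the
      origin is interior to \<open>P\<close>, and \<open>f\<close> is positive there.\<close>
    obtain e where e: "e > 0" "ball 0 e \<subseteq> P"
      using zero_interior by (auto simp: mem_interior)
    define s where "s = (\<chi> i. \<tau> i)"
    define d where "d = e / (2 * (norm s + 1))"
    have d: "d > 0"
      using e(1) by (simp add: d_def add_nonneg_pos)
    have "norm (d *\<^sub>R s) < e"
    proof -
      have "norm (d *\<^sub>R s) \<le> d * (norm s + 1)"
        using d by simp
      also have "\<dots> = e / 2"
        by (simp add: d_def add_nonneg_eq_0_iff field_simps)
      finally show ?thesis using e(1) by simp
    qed
    then have "d *\<^sub>R s \<in> P"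
      using e by auto
    moreover have "0 \<le> \<tau> i * (d * \<tau> i)" for i
      using d mult_nonneg_nonneg[of d "\<tau> i * \<tau> i"] by (simp add: ac_simps)
    ultimately have "d *\<^sub>R s \<in> C"
      using d by (auto simp: C_def s_def I_def)
    moreover have "f (d *\<^sub>R s) > 0"
      unfolding f_def s_def using \<tau> d by (intro prod_pos) fastforce
    ultimately show ?thesis
      using xmax by force
  qed
  then have xpos: "\<tau> i * x $ i > 0" if "i \<in> I" for i
    using that x by (fastforce simp: f_def C_def less_le prod_zero_iff)
  have xI: "x $ i = 0" if "i \<notin> I" for i
    using x that by (simp add: C_def)
  define a where "a = (\<chi> i. inverse (x $ i))"
  have sgx: "sgn (x $ i) = \<tau> i" for i
    using xpos[of i] \<tau>[of i] xI[of i] by (cases "i \<in> I") (auto simp: I_def)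
  have main: "a \<bullet> y \<le> a \<bullet> x" if y: "y \<in> C" for y
  proof -
    \<comment> \<open>Moving from \<open>x\<close> towards \<open>y\<close> by the fraction
      \<open>t\<close> multiplies \<open>f\<close> by the product of the \<open>1 + t * r i\<close>,
      and the sum of the \<open>r i\<close> is \<open>a \<bullet> y - a \<bullet> x\<close>.\<close>
    define r where "r i = y $ i / x $ i - 1" for i
    have "(\<Sum>i\<in>I. r i) \<le> 0"
    proof (rule prod_le_imp_sum_nonpos)
      fix t :: real
      assume t: "0 < t" "t \<le> 1"
      define z where "z = (1 - t) *\<^sub>R x + t *\<^sub>R y"
      have "z \<in> P"
        unfolding z_def using t x y by (intro convexD[OF convex_P]) (auto simp: C_def)
      moreover have "\<tau> i * z $ i = (1 - t) * (\<tau> i * x $ i) + t * (\<tau> i * y $ i)" for i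
        by (simp add: z_def algebra_simps)
      ultimately have "z \<in> C"
        using t x y by (auto simp: C_def z_def)
      then have "f z \<le> f x"
        by (rule xmax)
      moreover have "f z = f x * (\<Prod>i\<in>I. 1 + t * r i)"
        unfolding f_def prod.distrib[symmetric]
      proof (rule prod.cong)
        fix i assume "i \<in> I"
        then have "x $ i \<noteq> 0"
          using xpos by force
        then show "\<tau> i * z $ i = \<tau> i * x $ i * (1 + t * r i)"
          by (simp add: z_def r_def field_simps)
      qed simp
      ultimately show "(\<Prod>i\<in>I. 1 + t * r i) \<le> 1"
        using \<open>f x > 0\<close> by simp
    qed simp
    moreover have "a \<bullet> y - a \<bullet> x = (\<Sum>i\<in>I. r i)"
    proof -
      have "a \<bullet> y - a \<bullet> x = (\<Sum>i\<in>UNIV. inverse (x $ i) * (y $ i - x $ i))"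
        by (simp add: inner_vec_def a_def sum_subtractf algebra_simps)
      also have "\<dots> = (\<Sum>i\<in>I. inverse (x $ i) * (y $ i - x $ i))"
        by (rule sum.mono_neutral_right) (auto simp: xI)
      also have "\<dots> = (\<Sum>i\<in>I. r i)"
      proof (rule sum.cong)
        fix i assume "i \<in> I"
        then have "x $ i \<noteq> 0"
          using xpos by force
        then show "inverse (x $ i) * (y $ i - x $ i) = r i"
          by (simp add: r_def field_simps)
      qed simp
      finally show ?thesis .
    qed
    ultimately show ?thesis by simp
  qed
  have "a \<bullet> y \<le> a \<bullet> x" if y: "y \<in> P" for y
  proof -
    \<comment> \<open>To pass from \<open>C\<close> to \<open>P\<close>, drop the coordinates of
      \<open>y\<close> that are outside the support or have the wrong sign. The result stays in
      \<open>P\<close>, and the value of \<open>a\<close> does not decrease.\<close>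
    define y' where "y' = coord_proj {i \<in> I. \<tau> i * y $ i \<ge> 0} y"
    have "y' \<in> C"
      using proj_P[OF y, of "{i \<in> I. \<tau> i * y $ i \<ge> 0}"] by (auto simp: C_def y'_def coord_proj_def)
    moreover have "a \<bullet> y \<le> a \<bullet> y'"
      unfolding inner_vec_def
    proof (rule sum_mono)
      fix i
      show "a $ i \<bullet> y $ i \<le> a $ i \<bullet> y' $ i"
      proof (cases "i \<in> I \<and> \<tau> i * y $ i < 0")
        case True
        then have "a $ i * y $ i \<le> 0"
          using xpos[of i] \<tau>[of i] by (auto simp: a_def mult_le_0_iff)
        with True show ?thesis
          by (simp add: y'_def coord_proj_def)
      next
        case False
        then show ?thesis
          using xI[of i] by (auto simp: y'_def coord_proj_def a_def)
      qed
    qed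
    ultimately show ?thesis
      using main by force
  qed
  moreover have "sgn (a $ i) = \<tau> i" for i
    using sgx[of i] by (simp add: a_def) (metis inverse_sgn sgn_inverse sgx sgn_sgn sgn_real_def inverse_minus_eq inverse_1 inverse_zero inverse_eq_divide)
  ultimately have "good_pair \<tau> x a"
    using x sgx by (auto simp: good_pair_def C_def)
  then show ?thesis by blast
qed

lemma ex_good_face:
  assumes "\<tau> \<in> sign_vectors"
  shows "\<exists>F. good_face \<tau> F"
  using ex_good_pair[OF assms] good_pair_face by metis

abbreviation faces :: "(real ^ 'n) set set" where
  "faces \<equiv> {F. F face_of P \<and> F \<noteq> {}}"

lemma finite_faces: "finite faces"
  using finite_polytope_faces[OF polytope_P] by (rule rev_finite_subset) auto

definition sign_face :: "('n \<Rightarrow> real) \<Rightarrow> (real ^ 'n) set" where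
  "sign_face \<tau> = (SOME F. good_face \<tau> F)"

lemma good_face_sign_face: "\<tau> \<in> sign_vectors \<Longrightarrow> good_face \<tau> (sign_face \<tau>)"
  unfolding sign_face_def using ex_good_face by (rule someI_ex)

lemma good_face_faces: "good_face \<tau> F \<Longrightarrow> F \<in> faces"
  by (auto simp: good_face_def)

lemma inj_sign_face: "inj_on sign_face sign_vectors"
  using good_face_sign_face good_face_unique_sign by (metis inj_onI)

lemma sign_face_image: "sign_face ` sign_vectors \<subseteq> faces"
  using good_face_sign_face good_face_faces by blast

lemma card_faces_ge: "3 ^ CARD('n) \<le> num_nonempty_faces P"
  unfolding num_nonempty_faces_def card_sign_vectors[symmetric]
  by (rule card_inj_on_le[OF inj_sign_face sign_face_image finite_faces])

end

section \<open>Consequences of equality for good faces\<close>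

locale min_lab_polytope = lab_polytope P for P :: "(real ^ 'n::finite) set" +
  assumes card_eq: "num_nonempty_faces P = 3 ^ CARD('n)"
begin

lemma sign_face_image_eq: "sign_face ` sign_vectors = faces"
proof (rule card_subset_eq[OF finite_faces sign_face_image])
  show "card (sign_face ` sign_vectors) = card faces"
    using card_eq by (simp add: card_image[OF inj_sign_face] card_sign_vectors num_nonempty_faces_def)
qed

lemma every_face_good: "F \<in> faces \<Longrightarrow> \<exists>\<tau>. good_face \<tau> F"
  using sign_face_image_eq good_face_sign_face by (metis imageE)

text \<open>Every nonempty face is the chosen face of some sign vector and is good for only one, so
  both faces are \<open>sign_face \<tau>\<close>.\<close>

lemma good_face_unique:
  assumes "good_face \<tau> F" "good_face \<tau> G"
  shows "F = G"
  using assms sign_face_image_eq good_face_faces good_face_sign_face good_face_unique_sign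
  by (metis (no_types, lifting) imageE)

text \<open>Both points are relatively interior to the same face, and a normal from a good pair of
  this face is constant on it.\<close>

lemma good_pairs_tight:
  assumes "good_pair \<tau> x a" "good_pair \<tau> x' a'"
  shows "a' \<bullet> x = a' \<bullet> x'"
proof -
  obtain F where F: "good_face \<tau> F" "x \<in> rel_interior F"
    using good_pair_face[OF assms(1)] by blast
  obtain G where G: "good_face \<tau> G" "G face_of P" "x' \<in> rel_interior G"
    using good_pair_face[OF assms(2)] by blast
  have "x \<in> G"
    using good_face_unique[OF F(1) G(1)] F(2) rel_interior_subset by blast
  then show ?thesis
    by (rule good_pair_const_on_face[OF G(2,3) assms(2)])
qed

end

section \<open>Dual pairs of anti-blocking bodies\<close>

definition ind :: "'n set \<Rightarrow> real ^ 'n::finite" where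
  "ind S = (\<chi> i. if i \<in> S then 1 else 0)"

lemma ind_nth [simp]: "ind S $ i = (if i \<in> S then 1 else 0)"
  by (simp add: ind_def)

lemma inner_ind: "x \<bullet> ind S = (\<Sum>i\<in>S. x $ i)"
  by (simp add: inner_vec_def if_distrib[of "\<lambda>t. _ * t"] sum.If_cases cong: if_cong)

lemma inner_ind_left: "ind S \<bullet> x = (\<Sum>i\<in>S. x $ i)"
  by (subst inner_commute) (rule inner_ind)

lemma ind_singleton: "ind {i} = axis i 1"
  by (simp add: vec_eq_iff axis_def)

text \<open>The two sets are polar to each other within the nonnegative orthant, normalized so that
  every coordinate has maximum 1 on both. The condition \<open>tight\<close> is what equality yields
  for one orthant of \<open>P\<close> after rescaling. All conditions are symmetric, so each result
  has a mirror image through \<open>swap\<close>.\<close>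

locale dual_pair =
  fixes X Y :: "(real ^ 'n::finite) set"
  assumes X_iff: "x \<in> X \<longleftrightarrow> (\<forall>i. 0 \<le> x $ i) \<and> (\<forall>y\<in>Y. x \<bullet> y \<le> 1)"
    and Y_iff: "y \<in> Y \<longleftrightarrow> (\<forall>i. 0 \<le> y $ i) \<and> (\<forall>x\<in>X. x \<bullet> y \<le> 1)"
    and axis_X: "axis i 1 \<in> X"
    and axis_Y: "axis i 1 \<in> Y"
    and tight: "\<lbrakk>x \<in> X; x' \<in> X; y \<in> Y; y' \<in> Y; x \<bullet> y = 1; x' \<bullet> y' = 1;
      \<And>i. x $ i \<noteq> 0 \<longleftrightarrow> i \<in> S; \<And>i. x' $ i \<noteq> 0 \<longleftrightarrow> i \<in> S;
      \<And>i. y $ i \<noteq> 0 \<longleftrightarrow> i \<in> S; \<And>i. y' $ i \<noteq> 0 \<longleftrightarrow> i \<in> S\<rbrakk> \<Longrightarrow> x \<bullet> y' = 1"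
begin

lemma swap: "dual_pair Y X"
proof
  show "x \<in> Y \<longleftrightarrow> (\<forall>i. 0 \<le> x $ i) \<and> (\<forall>y\<in>X. x \<bullet> y \<le> 1)" for x
    by (subst Y_iff) (simp add: inner_commute)
  show "y \<in> X \<longleftrightarrow> (\<forall>i. 0 \<le> y $ i) \<and> (\<forall>x\<in>Y. x \<bullet> y \<le> 1)" for y
    by (subst X_iff) (simp add: inner_commute)
  show "x \<bullet> y' = 1"
    if "x \<in> Y" "x' \<in> Y" "y \<in> X" "y' \<in> X" "x \<bullet> y = 1" "x' \<bullet> y' = 1"
      "\<And>i. x $ i \<noteq> 0 \<longleftrightarrow> i \<in> S" "\<And>i. x' $ i \<noteq> 0 \<longleftrightarrow> i \<in> S"
      "\<And>i. y $ i \<noteq> 0 \<longleftrightarrow> i \<in> S" "\<And>i. y' $ i \<noteq> 0 \<longleftrightarrow> i \<in> S" for x x' y y' S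
    using tight[of y' y x' x S] that by (metis inner_commute)
qed (fact axis_X axis_Y)+

lemma inner_le: "x \<in> X \<Longrightarrow> y \<in> Y \<Longrightarrow> x \<bullet> y \<le> 1"
  using X_iff by blast

lemma nonneg_X: "x \<in> X \<Longrightarrow> 0 \<le> x $ i"
  using X_iff by blast

lemma nonneg_Y: "y \<in> Y \<Longrightarrow> 0 \<le> y $ i"
  using Y_iff by blast

lemma nth_le_X: "x \<in> X \<Longrightarrow> x $ i \<le> 1"
  using inner_le[OF _ axis_Y, of x i] by (simp add: inner_axis)

lemma down_closed_X:
  assumes "x \<in> X" "\<And>i. 0 \<le> z $ i" "\<And>i. z $ i \<le> x $ i"
  shows "z \<in> X"
proof -
  have "z \<bullet> y \<le> x \<bullet> y" if "y \<in> Y" for y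
    unfolding inner_vec_def using assms nonneg_Y[OF that]
    by (intro sum_mono) (simp add: mult_right_mono)
  with assms show ?thesis
    by (meson X_iff inner_le order_trans)
qed

lemma convex_X: "convex X"
proof (rule convexI)
  fix x y and u v :: real
  assume "x \<in> X" "y \<in> X" "0 \<le> u" "0 \<le> v" "u + v = 1"
  then show "u *\<^sub>R x + v *\<^sub>R y \<in> X"
    by (subst X_iff) (auto simp: inner_add_left nonneg_X intro!: convex_bound_le inner_le)
qed

lemma closed_X: "closed X"
proof -
  have "X = (\<Inter>i. {x. 0 \<le> x $ i}) \<inter> (\<Inter>y\<in>Y. {x. x \<bullet> y \<le> 1})"
    using X_iff by auto
  also have "closed \<dots>"
    by (intro closed_Int closed_INT ballI)
      (auto simp: closed_halfspace_component_ge_cart inner_commute[of _ "_ :: real ^ 'n"] closed_halfspace_le)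
  finally show ?thesis .
qed

lemma compact_X: "compact X"
proof -
  have "X \<subseteq> cbox 0 1"
    using nonneg_X nth_le_X by (auto simp: mem_box_cart)
  then show ?thesis
    using closed_X bounded_cbox bounded_subset compact_eq_bounded_closed by blast
qed

lemma compact_Y: "compact Y"
  using dual_pair.compact_X[OF swap] .

lemma convex_Y: "convex Y"
  using dual_pair.convex_X[OF swap] .

lemma down_closed_Y: "y \<in> Y \<Longrightarrow> (\<And>i. 0 \<le> z $ i) \<Longrightarrow> (\<And>i. z $ i \<le> y $ i) \<Longrightarrow> z \<in> Y"
  using dual_pair.down_closed_X[OF swap] .

text \<open>If the maximum of \<open>x \<bullet> y\<close> over the compact set \<open>Y\<close>
  were below 1, some multiple of \<open>x\<close> by a factor above 1 would still be in
  \<open>X\<close>. Coordinates of \<open>y\<close> outside \<open>S\<close> can be set to 0, as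
  \<open>x\<close> vanishes there.\<close>

lemma ex_tight:
  assumes x: "x \<in> X" and S: "\<And>i. x $ i \<noteq> 0 \<Longrightarrow> i \<in> S" and bd: "\<And>r. r > 1 \<Longrightarrow> r *\<^sub>R x \<notin> X"
  obtains y where "y \<in> Y" "x \<bullet> y = 1" "\<And>i. i \<notin> S \<Longrightarrow> y $ i = 0"
proof -
  have "Y \<noteq> {}"
    using axis_Y by blast
  moreover have "continuous_on Y (\<lambda>v. x \<bullet> v)"
    by (intro continuous_intros)
  ultimately obtain y where y: "y \<in> Y" and ymax: "\<And>v. v \<in> Y \<Longrightarrow> x \<bullet> v \<le> x \<bullet> y"
    using continuous_attains_sup[OF compact_Y] by blast
  have "x \<bullet> y = 1"
  proof (rule ccontr)
    assume "x \<bullet> y \<noteq> 1"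
    then have lt: "x \<bullet> y < 1"
      using inner_le[OF x y] by simp
    have ge: "0 \<le> x \<bullet> y"
      unfolding inner_vec_def using nonneg_X[OF x] nonneg_Y[OF y] by (auto intro: sum_nonneg)
    \<comment> \<open>Any factor above 1 and at most the reciprocal of \<open>x \<bullet> y\<close>
      would do; this one is also meaningful when \<open>x \<bullet> y = 0\<close>.\<close>
    define r where "r = 2 / (1 + x \<bullet> y)"
    have r: "r > 1" "r * (x \<bullet> y) \<le> 1"
      using lt ge by (auto simp: r_def field_simps)
    have "r *\<^sub>R x \<bullet> v \<le> 1" if "v \<in> Y" for v
    proof -
      have "r * (x \<bullet> v) \<le> r * (x \<bullet> y)"
        using ymax[OF that] r by (intro mult_left_mono) auto
      with r(2) show ?thesis
        unfolding inner_scaleR_left by linarith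
    qed
    then have "r *\<^sub>R x \<in> X"
      using r nonneg_X[OF x] by (subst X_iff) auto
    with bd r show False by blast
  qed
  moreover define z where "z = (\<chi> i. if i \<in> S then y $ i else 0)"
  have "z \<in> Y"
    by (rule down_closed_Y[OF y]) (auto simp: z_def nonneg_Y[OF y])
  moreover have "x \<bullet> z = x \<bullet> y"
    unfolding inner_vec_def z_def by (rule sum.cong) (use S in auto)
  ultimately show ?thesis
    using that[of z] by (simp add: z_def)
qed

text \<open>A boundary point \<open>l *\<^sub>R ind S\<close> has a normal \<open>b\<close> that is positive on \<open>S\<close>. By tightness \<open>b\<close> stays
  normal while the coordinate \<open>i\<close> of the point is raised to its maximal value \<open>1\<close> and the others are
  lowered along the boundary. If the others were still positive at that moment, then mixing \<open>b\<close> with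
  the second normal \<open>axis i 1\<close> would violate tightness at \<open>l *\<^sub>R ind S\<close>; so they vanish and \<open>b $ i = 1\<close>.\<close>

lemma ind_dichotomy:
  assumes card: "card S \<ge> 2" and sub: "\<And>i. i \<in> S \<Longrightarrow> ind (S - {i}) \<in> X" and notin: "ind S \<notin> X"
  shows "card S = 2 \<and> ind S \<in> Y"
proof -
  define L where "L = {t::real. t *\<^sub>R ind S \<in> X}"
  obtain i0 where i0: "i0 \<in> S"
    using card by fastforce
  have Lle: "t < 1" if "t \<in> L" for t
  proof (rule ccontr)
    assume "\<not> t < 1"
    then have "ind S \<in> X"
      using that down_closed_X[of "t *\<^sub>R ind S" "ind S"] by (auto simp: L_def)
    with notin show False ..
  qed
  have "closed L"
  proof -
    have "L = (\<lambda>t. t *\<^sub>R ind S) -` X"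
      by (auto simp: L_def)
    then show ?thesis
      by (simp add: closed_X continuous_closed_vimage)
  qed
  moreover have L0: "1 / card S \<in> L"
  proof -
    have "(\<Sum>i\<in>S. (1 / card S) *\<^sub>R axis i 1) \<in> X"
      using card by (intro convex_sum[OF _ convex_X]) (auto simp: axis_X)
    moreover have "(\<Sum>i\<in>S. (1 / card S) *\<^sub>R axis i 1) = (1 / card S) *\<^sub>R (ind S :: real ^ 'n)"
      by (simp add: vec_eq_iff axis_def if_distrib[of "\<lambda>t. _ * t"] sum.delta' cong: if_cong)
    ultimately show ?thesis
      by (simp add: L_def)
  qed
  moreover have "bdd_above L"
    using Lle by (auto intro!: bdd_aboveI[of _ 1] less_imp_le)
  moreover define l where "l = Sup L"
  ultimately have lL: "l \<in> L" and lmax: "\<And>t. t \<in> L \<Longrightarrow> t \<le> l"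
    using closed_contains_Sup[of L] cSup_upper[of _ L] by auto
  have l1: "l < 1" and l0: "l > 0"
    using Lle[OF lL] lmax[OF L0] card by (auto intro: less_le_trans[rotated])
  have lX: "l *\<^sub>R ind S \<in> X"
    using lL by (simp add: L_def)
  have "r *\<^sub>R (l *\<^sub>R ind S) \<notin> X" if "r > 1" for r
  proof
    assume "r *\<^sub>R (l *\<^sub>R ind S) \<in> X"
    then have "r * l \<le> l"
      by (intro lmax) (simp add: L_def)
    with that l0 show False by simp
  qed
  moreover have "i \<in> S" if "(l *\<^sub>R ind S) $ i \<noteq> 0" for i
    using that by (auto split: if_splits)
  ultimately obtain b where b: "b \<in> Y" "l *\<^sub>R ind S \<bullet> b = 1" "\<And>i. i \<notin> S \<Longrightarrow> b $ i = 0"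
    using ex_tight[OF lX] by blast
  have bsum: "l * (\<Sum>i\<in>S. b $ i) = 1"
    using b(2) by (simp add: inner_ind_left)
  have sum_le: "(\<Sum>j\<in>S - {i}. y $ j) \<le> 1" if "i \<in> S" "y \<in> Y" for i y
    using inner_le[OF sub[OF that(1)] that(2)] by (simp add: inner_ind_left)
  \<comment> \<open>The coordinates of \<open>b\<close> sum to \<open>1 / l > 1\<close>, but those
    on \<open>S - {i}\<close> sum to at most 1 because \<open>ind (S - {i})\<close> is in
    \<open>X\<close>.\<close>
  have bpos: "b $ i > 0" if "i \<in> S" for i
  proof -
    have "(\<Sum>i\<in>S. b $ i) > 1"
    proof (rule ccontr)
      assume "\<not> ?thesis"
      then have "l * (\<Sum>i\<in>S. b $ i) \<le> l * 1"
        using l0 by (intro mult_left_mono) auto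
      with bsum l1 show False by simp
    qed
    then show ?thesis
      using sum_le[OF that b(1)] that by (simp add: sum_diff1)
  qed
  have bS: "b $ i \<noteq> 0 \<longleftrightarrow> i \<in> S" for i
    using bpos[of i] b(3)[of i] by (cases "i \<in> S") auto
  have lS: "(l *\<^sub>R ind S) $ i \<noteq> 0 \<longleftrightarrow> i \<in> S" for i
    using l0 by simp
  have "b $ i = 1" if i: "i \<in> S" for i
  proof -
    define D where "D = S - {i}"
    have D: "D \<noteq> {}"
    proof
      assume "D = {}"
      then have "S \<subseteq> {i}"
        by (auto simp: D_def)
      then show False
        using card card_mono[of "{i}" S] by simp
    qed
    have SD: "S = insert i D" "i \<notin> D"
      using i by (auto simp: D_def)
    define z where "z t m = (\<chi> j. if j = i then t else if j \<in> D then m else 0)" for t m :: real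
    have z_nth: "z t m $ j = (if j = i then t else if j \<in> D then m else 0)" for t m j
      by (simp add: z_def)
    have z_inner: "z t m \<bullet> y = t * y $ i + m * (\<Sum>j\<in>D. y $ j)" for t m y
    proof -
      have "z t m = t *\<^sub>R ind {i} + m *\<^sub>R ind D"
        using SD(2) by (auto simp: vec_eq_iff z_nth)
      then show ?thesis
        by (simp add: inner_add_left inner_ind_left)
    qed
    have zS: "z t m $ j \<noteq> 0 \<longleftrightarrow> j \<in> S" if "t \<noteq> 0" "m \<noteq> 0" for t m j
      using that SD by (auto simp: z_nth)
    define s where "s = (\<Sum>j\<in>D. b $ j)"
    have s0: "s > 0"
      unfolding s_def using D bpos SD by (intro sum_pos) auto
    have bt: "t * b $ i + m * s = 1 \<Longrightarrow> m = (1 - t * b $ i) / s" for t m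
      using s0 by (simp add: field_simps)
    \<comment> \<open>With coordinate \<open>i\<close> fixed at \<open>t\<close>, take the largest
      common value \<open>m\<close> of the other coordinates on \<open>S\<close> and a normal
      \<open>c\<close> there. Once \<open>c\<close> is positive on all of \<open>S\<close>,
      tightness makes \<open>b\<close> normal at this point too, which determines
      \<open>m\<close>.\<close>
    have zX: "z t ((1 - t * b $ i) / s) \<in> X" if t: "l < t" "t < 1" for t
    proof -
      define M where "M = {m. z t m \<in> X}"
      \<comment> \<open>Otherwise \<open>X\<close> would contain a multiple of \<open>ind S\<close>
        with a factor above \<open>l\<close>.\<close>
      have Mle: "m \<le> l" if "m \<in> M" for m
      proof (rule ccontr)
        assume "\<not> m \<le> l"
        then have "min t m *\<^sub>R ind S \<in> X"
          using that t l0 by (rule_tac down_closed_X[of "z t m"]) (auto simp: M_def z_nth SD)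
        then have "min t m \<le> l"
          by (intro lmax) (simp add: L_def)
        with t \<open>\<not> m \<le> l\<close> show False by simp
      qed
      have "(1 - t) \<in> M"
      proof -
        have "t *\<^sub>R axis i 1 + (1 - t) *\<^sub>R ind D \<in> X"
          using t l0 sub[OF i] by (intro convexD[OF convex_X]) (auto simp: axis_X D_def)
        moreover have "t *\<^sub>R axis i 1 + (1 - t) *\<^sub>R ind D = z t (1 - t)"
          using SD(2) by (auto simp: vec_eq_iff z_nth axis_def)
        ultimately show ?thesis
          by (simp add: M_def)
      qed
      moreover have "closed M"
      proof -
        have "continuous_on UNIV (\<lambda>m. z t m $ j)" for j
          by (cases "j = i"; cases "j \<in> D"; simp add: z_nth)
        then have "continuous_on UNIV (z t)"
          unfolding z_def by (intro continuous_on_vec_lambda) simp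
        moreover have "M = z t -` X"
          by (auto simp: M_def)
        ultimately show ?thesis
          by (simp add: closed_X closed_vimage)
      qed
      moreover have "bdd_above M"
        using Mle by (rule bdd_aboveI)
      moreover define m where "m = Sup M"
      ultimately have mM: "m \<in> M" and mmax: "\<And>u. u \<in> M \<Longrightarrow> u \<le> m" and "1 - t \<le> m"
        using closed_contains_Sup[of M] cSup_upper[of _ M] by auto
      then have m0: "m > 0"
        using t by simp
      have m1: "m < 1"
        using Mle[OF mM] l1 by simp
      have zm: "z t m \<in> X"
        using mM by (simp add: M_def)
      have "r *\<^sub>R z t m \<notin> X" if "r > 1" for r
      proof
        assume "r *\<^sub>R z t m \<in> X"
        then have "z t (r * m) \<in> X"
          using t l0 m0 that by (rule_tac down_closed_X) (auto simp: z_nth)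
        then have "r * m \<le> m"
          by (intro mmax) (simp add: M_def)
        with that m0 show False by simp
      qed
      moreover have "j \<in> S" if "z t m $ j \<noteq> 0" for j
        using that by (auto simp: z_nth SD split: if_splits)
      ultimately obtain c where c: "c \<in> Y" "z t m \<bullet> c = 1" "\<And>j. j \<notin> S \<Longrightarrow> c $ j = 0"
        using ex_tight[OF zm] by blast
      define q where "q = (\<Sum>j\<in>D. c $ j)"
      have q0: "q \<ge> 0"
        unfolding q_def by (simp add: sum_nonneg nonneg_Y[OF c(1)])
      have ci: "c $ i \<ge> 0"
        by (rule nonneg_Y[OF c(1)])
      have cq: "t * c $ i + m * q = 1"
        using c(2) by (simp add: z_inner q_def)
      \<comment> \<open>If one coordinate of \<open>c\<close> vanishes, the others on
        \<open>S\<close> sum to at most 1. They are weighted by \<open>t\<close> and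
        \<open>m\<close>, both below 1, so the weighted sum cannot reach 1.\<close>
      have "c $ k \<noteq> 0" if k: "k \<in> S" for k
      proof
        assume ck: "c $ k = 0"
        show False
        proof (cases "k = i")
          case True
          then have "m * q = 1" "q \<le> 1"
            using cq ck sum_le[OF i c(1)] by (auto simp: q_def D_def)
          moreover have "m * q \<le> m * 1"
            using m0 \<open>q \<le> 1\<close> by (intro mult_left_mono) auto
          ultimately show False
            using m1 by simp
        next
          case False
          have "(\<Sum>j\<in>S - {k}. c $ j) = (\<Sum>j\<in>S. c $ j)"
            using ck k by (simp add: sum_diff1)
          also have "\<dots> = c $ i + q"
            using SD by (simp add: q_def)
          finally have "c $ i + q \<le> 1"
            using sum_le[OF k c(1)] by simp
          moreover have "t * c $ i \<le> c $ i" "m * q \<le> q"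
            using t m1 m0 l0 ci q0 by (auto intro: mult_left_le_one_le)
          ultimately have "t * c $ i = c $ i" "m * q = q"
            using cq by linarith+
          then have "c $ i = 0" "q = 0"
            using t m1 by auto
          with cq show False by simp
        qed
      qed
      with c(3) have cS: "c $ k \<noteq> 0 \<longleftrightarrow> k \<in> S" for k
        by blast
      have "z t m \<bullet> b = 1"
        by (rule tight[OF zm lX c(1) b(1) c(2) b(2) zS lS cS bS]) (use t l0 m0 in auto)
      then have "m = (1 - t * b $ i) / s"
        by (intro bt) (simp add: z_inner s_def)
      with zm show ?thesis by simp
    qed
    define m where "m = (1 - b $ i) / s"
    \<comment> \<open>The value \<open>1 - t\<close> kept \<open>m\<close> positive for
      \<open>t < 1\<close>; the case \<open>t = 1\<close> is a limit and uses that \<open>X\<close>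
      is closed.\<close>
    have "z 1 m \<in> X"
    proof -
      have "((\<lambda>t. z t ((1 - t * b $ i) / s)) \<longlongrightarrow> z 1 ((1 - 1 * b $ i) / s)) (at_left 1)"
      proof (rule vec_tendstoI)
        fix j
        show "((\<lambda>t. z t ((1 - t * b $ i) / s) $ j) \<longlongrightarrow> z 1 ((1 - 1 * b $ i) / s) $ j) (at_left 1)"
          using s0 by (cases "j = i"; cases "j \<in> D") (auto simp: z_nth intro!: tendsto_eq_intros)
      qed
      moreover have "eventually (\<lambda>t. z t ((1 - t * b $ i) / s) \<in> X) (at_left 1)"
        using zX l1 by (auto simp: eventually_at_left[OF l1])
      ultimately show ?thesis
        using Lim_in_closed_set[OF closed_X, of "\<lambda>t. z t ((1 - t * b $ i) / s)" "at_left (1::real)"]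
        by (simp add: m_def)
    qed
    moreover have "m = 0"
    proof (rule ccontr)
      assume "m \<noteq> 0"
      define c where "c = (1/2) *\<^sub>R b + (1/2) *\<^sub>R axis i 1"
      have "c \<in> Y"
        unfolding c_def by (intro convexD[OF convex_Y]) (auto simp: b axis_Y)
      have "z 1 m \<bullet> b = 1"
        using s0 by (simp add: z_inner m_def s_def)
      then have zc: "z 1 m \<bullet> c = 1"
        by (simp add: c_def inner_add_right inner_axis z_nth)
      have cS: "c $ j \<noteq> 0 \<longleftrightarrow> j \<in> S" for j
        using bpos[of j] b(3)[of j] i by (cases "j \<in> S") (auto simp: c_def axis_def)
      have "l *\<^sub>R ind S \<bullet> c = 1"
        by (rule tight[OF lX \<open>z 1 m \<in> X\<close> b(1) \<open>c \<in> Y\<close> b(2) zc lS zS bS cS]) (use \<open>m \<noteq> 0\<close> in auto)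
      moreover have "l *\<^sub>R ind S \<bullet> c = 1/2 + l/2"
        using b(2) i by (simp add: c_def inner_add_right inner_axis)
      ultimately show False
        using l1 by simp
    qed
    ultimately show ?thesis
      using s0 by (simp add: m_def)
  qed
  then have "b = ind S"
    using b(3) by (auto simp: vec_eq_iff)
  then have "ind S \<in> Y"
    using b(1) by simp
  \<comment> \<open>Summing \<open>ind S\<close> over \<open>S\<close> without one element gives
    \<open>card S - 1\<close>, which \<open>sum_le\<close> bounds by 1.\<close>
  moreover have "card S \<le> 2"
    using sum_le[OF i0 \<open>ind S \<in> Y\<close>] i0 by simp
  ultimately show ?thesis
    using card by simp
qed

text \<open>In a minimal counterexample all \<open>ind (S - {i})\<close> are in \<open>X\<close>, so
  \<open>ind_dichotomy\<close> leaves only two-element sets, which the hypothesis covers. This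
  serves stable sets and, on the swapped pair, cliques.\<close>

lemma ind_stable:
  assumes "\<And>i j. i \<in> S \<Longrightarrow> j \<in> S \<Longrightarrow> i \<noteq> j \<Longrightarrow> ind {i, j} \<in> X"
  shows "ind S \<in> X"
  using assms
proof (induction "card S" arbitrary: S rule: less_induct)
  case less
  consider "S = {}" | i where "S = {i}" | "card S \<ge> 2"
    by (metis card_1_singleton_iff card_eq_0_iff finite less_2_cases not_le One_nat_def)
  then show ?case
  proof cases
    case 1
    then show ?thesis
      using down_closed_X[OF axis_X, of "ind {}"] by (simp add: axis_def)
  next
    case 2
    then show ?thesis by (simp add: ind_singleton axis_X)
  next
    case 3
    show ?thesis
    proof (rule ccontr)
      assume "ind S \<notin> X"
      moreover have "ind (S - {i}) \<in> X" if "i \<in> S" for i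
        using that less by (metis DiffD1 card_Diff1_less finite)
      ultimately have "card S = 2"
        using ind_dichotomy[OF 3] by blast
      then obtain i j where "S = {i, j}" "i \<noteq> j"
        by (auto simp: card_2_iff)
      with less.prems[of i j] \<open>ind S \<notin> X\<close> show False by simp
    qed
  qed
qed

text \<open>The plane section is a square or a triangle: \<open>ind {i, j}\<close> has product 2
  with itself and so cannot lie in both sets, and the dichotomy puts it in at least one.\<close>

lemma ind_pair_cases:
  assumes "i \<noteq> j"
  shows "ind {i, j} \<in> Y \<longleftrightarrow> ind {i, j} \<notin> X"
proof
  assume "ind {i, j} \<in> Y"
  then show "ind {i, j} \<notin> X"
    using inner_le[of "ind {i,j}" "ind {i,j}"] assms by (auto simp: inner_ind)
next
  assume "ind {i, j} \<notin> X"
  moreover have "ind ({i, j} - {k}) \<in> X" if "k \<in> {i, j}" for k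
    using that assms by (auto simp: insert_Diff_if ind_singleton axis_X)
  ultimately show "ind {i, j} \<in> Y"
    using ind_dichotomy[of "{i, j}"] assms by auto
qed

lemma no_induced_path4:
  assumes dist: "distinct [i, j, k, l]"
    and Y: "ind {i, j} \<in> Y" "ind {j, k} \<in> Y" "ind {k, l} \<in> Y"
    and X: "ind {i, k} \<in> X" "ind {j, l} \<in> X" "ind {i, l} \<in> X"
  shows False
proof -
  have conv3X: "(1/4) *\<^sub>R u + (1/4) *\<^sub>R v + (1/2) *\<^sub>R w \<in> X" if "u \<in> X" "v \<in> X" "w \<in> X" for u v w
  proof -
    have "(1/2) *\<^sub>R ((1/2) *\<^sub>R u + (1/2) *\<^sub>R v) + (1/2) *\<^sub>R w \<in> X"
      using that by (intro convexD[OF convex_X]) auto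
    then show ?thesis by (simp add: scaleR_add_right)
  qed
  \<comment> \<open>Each given pair for \<open>X\<close> meets each given pair for \<open>Y\<close>
    in exactly one element, except that \<open>{i, l}\<close> misses \<open>{j, k}\<close>. Only
    \<open>x\<close> uses the former and only \<open>y'\<close> the latter, so
    \<open>x \<bullet> y'\<close> drops below 1 although all four vectors have support
    \<open>{i, j, k, l}\<close>.\<close>
  define x where "x = (1/4) *\<^sub>R ind {i, k} + (1/4) *\<^sub>R ind {j, l} + (1/2) *\<^sub>R (ind {i, l} :: real ^ 'n)"
  define x' where "x' = (1/2) *\<^sub>R ind {i, k} + (1/2) *\<^sub>R (ind {j, l} :: real ^ 'n)"
  define y where "y = (1/2) *\<^sub>R ind {i, j} + (1/2) *\<^sub>R (ind {k, l} :: real ^ 'n)"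
  define y' where "y' = (1/2) *\<^sub>R y + (1/2) *\<^sub>R (ind {j, k} :: real ^ 'n)"
  have mem: "x \<in> X" "x' \<in> X" "y \<in> Y" "y' \<in> Y"
  proof -
    show "x \<in> X"
      unfolding x_def by (intro conv3X X)
    show "x' \<in> X"
      unfolding x'_def using X by (intro convexD[OF convex_X]) auto
    show "y \<in> Y"
      unfolding y_def using Y by (intro convexD[OF convex_Y]) auto
    then show "y' \<in> Y"
      unfolding y'_def using Y by (intro convexD[OF convex_Y]) auto
  qed
  have "x \<bullet> y = 1" "x' \<bullet> y' = 1" "x \<bullet> y' = 3/4"
    using dist by (auto simp: x_def x'_def y_def y'_def inner_add_right inner_ind)
  moreover have "x \<bullet> y' = 1"
    using dist
    by (intro tight[OF mem \<open>x \<bullet> y = 1\<close> \<open>x' \<bullet> y' = 1\<close>, of "{i, j, k, l}"])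
      (auto simp: x_def x'_def y_def y'_def)
  ultimately show False by simp
qed

end

section \<open>Graphs without induced paths on four vertices\<close>

definition stable_set :: "('a \<Rightarrow> 'a \<Rightarrow> bool) \<Rightarrow> 'a set \<Rightarrow> bool" where
  "stable_set E S \<longleftrightarrow> (\<forall>i\<in>S. \<forall>j\<in>S. i \<noteq> j \<longrightarrow> \<not> E i j)"

definition clique :: "('a \<Rightarrow> 'a \<Rightarrow> bool) \<Rightarrow> 'a set \<Rightarrow> bool" where
  "clique E K \<longleftrightarrow> (\<forall>i\<in>K. \<forall>j\<in>K. i \<noteq> j \<longrightarrow> E i j)"

definition path4_free :: "('a \<Rightarrow> 'a \<Rightarrow> bool) \<Rightarrow> bool" where
  "path4_free E \<longleftrightarrow> \<not> (\<exists>i j k l. distinct [i, j, k, l] \<and> E i j \<and> E j k \<and> E k l \<and>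
    \<not> E i k \<and> \<not> E j l \<and> \<not> E i l)"

text \<open>The complement of a path on four vertices is again such a path, in the order
  \<open>k, i, l, j\<close>. This transfers statements about disjoint unions to joins.\<close>

lemma path4_free_complement:
  assumes "symp E" "path4_free E"
  shows "path4_free (\<lambda>i j. \<not> E i j)"
  unfolding path4_free_def
proof clarify
  fix i j k l
  assume "distinct [i, j, k, l]" "\<not> E i j" "\<not> E j k" "\<not> E k l" "E i k" "E j l" "E i l"
  then have "distinct [k, i, l, j] \<and> E k i \<and> E i l \<and> E l j \<and> \<not> E k l \<and> \<not> E i j \<and> \<not> E k j"
    using assms(1) by (auto dest: sympD)
  with assms(2) show False
    unfolding path4_free_def by blast
qed

text \<open>With adjacency for \<open>R\<close> this is a join, with its negation a disjoint
  union.\<close>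

definition split_by :: "('a \<Rightarrow> 'a \<Rightarrow> bool) \<Rightarrow> 'a set \<Rightarrow> 'a set \<Rightarrow> 'a set \<Rightarrow> bool" where
  "split_by R J A B \<longleftrightarrow> A \<noteq> {} \<and> B \<noteq> {} \<and> A \<inter> B = {} \<and> A \<union> B = J \<and> (\<forall>a\<in>A. \<forall>b\<in>B. R a b)"

lemma split_byI:
  "A \<noteq> {} \<Longrightarrow> B \<noteq> {} \<Longrightarrow> A \<inter> B = {} \<Longrightarrow> A \<union> B = J \<Longrightarrow> (\<And>a b. a \<in> A \<Longrightarrow> b \<in> B \<Longrightarrow> R a b) \<Longrightarrow> split_by R J A B"
  by (auto simp: split_by_def)

text \<open>The nonneighbours of \<open>v\<close> in \<open>A\<close> split off from all other
  vertices: an edge from such an \<open>x\<close> to a neighbour \<open>y\<close> of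
  \<open>v\<close> in \<open>A\<close> would complete the induced path
  \<open>b, v, y, x\<close>.\<close>

lemma split_by_insert_aux:
  assumes sym: "symp E" and free: "path4_free E" and v: "v \<notin> J" and split: "split_by (\<lambda>i j. \<not> E i j) J A B"
    and a: "a \<in> A" "\<not> E v a" and b: "b \<in> B" "E v b"
  shows "\<exists>A B. split_by (\<lambda>i j. \<not> E i j) (insert v J) A B"
proof -
  define A0 where "A0 = {x \<in> A. \<not> E v x}"
  have sp: "A \<inter> B = {}" "A \<union> B = J" "\<And>x y. x \<in> A \<Longrightarrow> y \<in> B \<Longrightarrow> \<not> E x y"
    using split by (auto simp: split_by_def)
  have "\<not> E x y" if x: "x \<in> A0" and y: "y \<in> insert v (J - A0)" for x y
  proof
    assume xy: "E x y"
    consider "y = v" | "y \<in> B" | "y \<in> A" "E v y"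
      using y sp by (auto simp: A0_def)
    then show False
    proof cases
      case 1
      then show False
        using x xy sympD[OF sym, of x v] by (simp add: A0_def)
    next
      case 2
      then show False
        using x xy sp by (auto simp: A0_def)
    next
      case 3
      have "E b v" "E y x" "\<not> E b y" "\<not> E b x" "\<not> E v x"
        using x xy b 3 sp(3)[of _ b] sympD[OF sym, of v b] sympD[OF sym, of x y]
          sympD[OF sym, of b y] sympD[OF sym, of b x] by (auto simp: A0_def)
      moreover have "distinct [b, v, y, x]"
        using x 3 b v sp \<open>\<not> E v x\<close> by (auto simp: A0_def)
      ultimately have "distinct [b, v, y, x] \<and> E b v \<and> E v y \<and> E y x \<and> \<not> E b y \<and> \<not> E v x \<and> \<not> E b x"
        using 3 by simp
      then show False
        using free unfolding path4_free_def by blast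
    qed
  qed
  moreover have "A0 \<noteq> {}"
    using a by (auto simp: A0_def)
  moreover have "A0 \<subseteq> J"
    using sp by (auto simp: A0_def)
  ultimately have "split_by (\<lambda>i j. \<not> E i j) (insert v J) A0 (insert v (J - A0))"
    using v by (intro split_byI) auto
  then show ?thesis by blast
qed

lemma split_by_insert:
  assumes sym: "symp E" and free: "path4_free E" and v: "v \<notin> J" and split: "split_by (\<lambda>i j. \<not> E i j) J A B"
  shows "\<exists>A B. split_by E (insert v J) A B \<or> split_by (\<lambda>i j. \<not> E i j) (insert v J) A B"
proof -
  have comm: "E x y \<longleftrightarrow> E y x" for x y
    using sym by (auto simp: symp_def)
  have split': "split_by (\<lambda>i j. \<not> E i j) J B A"
    using split comm unfolding split_by_def by blast
  have sp: "A \<noteq> {}" "B \<noteq> {}" "A \<inter> B = {}" "A \<union> B = J" "\<And>x y. x \<in> A \<Longrightarrow> y \<in> B \<Longrightarrow> \<not> E x y"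
    using split by (auto simp: split_by_def)
  \<comment> \<open>If \<open>v\<close> has a neighbour in each part but is not adjacent to
    everything, a nonneighbour in one part comes with a neighbour in the other.\<close>
  consider "\<forall>a\<in>A. \<not> E v a" | "\<forall>b\<in>B. \<not> E v b" | "\<forall>x\<in>J. E v x"
    | a b where "a \<in> A" "\<not> E v a" "b \<in> B" "E v b"
    | a b where "b \<in> B" "\<not> E v b" "a \<in> A" "E v a"
    using sp by blast
  then show ?thesis
  proof cases
    case 1
    then have "\<forall>a\<in>A. \<not> E a v"
      using comm by blast
    then have "split_by (\<lambda>i j. \<not> E i j) (insert v J) A (insert v B)"
      using sp v by (intro split_byI) auto
    then show ?thesis by blast
  next
    case 2
    then have "split_by (\<lambda>i j. \<not> E i j) (insert v J) (insert v A) B"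
      using sp v by (intro split_byI) auto
    then show ?thesis by blast
  next
    case 3
    then have "split_by E (insert v J) {v} J"
      using sp v by (intro split_byI) auto
    then show ?thesis by blast
  next
    case 4
    then show ?thesis
      using split_by_insert_aux[OF sym free v split] by blast
  next
    case 5
    then show ?thesis
      using split_by_insert_aux[OF sym free v split'] by blast
  qed
qed

text \<open>Vertices are added one at a time; a join is handled as a disjoint union in the
  complementary graph.\<close>

lemma path4_free_split:
  assumes sym: "symp E" and free: "path4_free E" and "finite J" "card J \<ge> 2"
  shows "\<exists>A B. split_by E J A B \<or> split_by (\<lambda>i j. \<not> E i j) J A B"
  using assms(3,4)
proof (induction J rule: finite_induct)
  case (insert v J)
  show ?case
  proof (cases "card J \<ge> 2")
    case True
    then obtain A B where "split_by E J A B \<or> split_by (\<lambda>i j. \<not> E i j) J A B"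
      using insert by blast
    then show ?thesis
    proof
      assume "split_by (\<lambda>i j. \<not> E i j) J A B"
      then show ?thesis
        using split_by_insert[OF sym free insert.hyps(2)] by blast
    next
      assume "split_by E J A B"
      moreover have "symp (\<lambda>i j. \<not> E i j)"
        using sym by (auto simp: symp_def)
      ultimately show ?thesis
        using split_by_insert[OF _ path4_free_complement[OF sym free] insert.hyps(2), of A B] by auto
    qed
  next
    case False
    then have "card J = 1"
      using insert by simp
    then obtain w where "J = {w}"
      by (auto simp: card_1_singleton_iff)
    then have "split_by E (insert v J) {v} {w} \<or> split_by (\<lambda>i j. \<not> E i j) (insert v J) {v} {w}"
      using insert.hyps by (auto simp: split_by_def)
    then show ?thesis by blast
  qed
qed simp

lemma path4_free_induct [consumes 4, case_names singleton join union]: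
  assumes sym: "symp E" and free: "path4_free E" and "finite J" "J \<noteq> {}"
    and "\<And>i. Q {i}"
    and "\<And>A B. finite A \<Longrightarrow> finite B \<Longrightarrow> A \<noteq> {} \<Longrightarrow> B \<noteq> {} \<Longrightarrow> A \<inter> B = {} \<Longrightarrow> (\<And>a b. a \<in> A \<Longrightarrow> b \<in> B \<Longrightarrow> E a b) \<Longrightarrow> Q A \<Longrightarrow> Q B \<Longrightarrow> Q (A \<union> B)"
    and "\<And>A B. finite A \<Longrightarrow> finite B \<Longrightarrow> A \<noteq> {} \<Longrightarrow> B \<noteq> {} \<Longrightarrow> A \<inter> B = {} \<Longrightarrow> (\<And>a b. a \<in> A \<Longrightarrow> b \<in> B \<Longrightarrow> \<not> E a b) \<Longrightarrow> Q A \<Longrightarrow> Q B \<Longrightarrow> Q (A \<union> B)"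
  shows "Q J"
  using assms(3,4)
proof (induction "card J" arbitrary: J rule: less_induct)
  case less
  show ?case
  proof (cases "card J \<ge> 2")
    case True
    then obtain A B where AB: "split_by E J A B \<or> split_by (\<lambda>i j. \<not> E i j) J A B"
      using path4_free_split[OF sym free] less.prems by blast
    then have *: "A \<noteq> {}" "B \<noteq> {}" "A \<inter> B = {}" "J = A \<union> B" "finite A" "finite B"
      using less.prems by (auto simp: split_by_def)
    then have "A \<subset> J" "B \<subset> J"
      by auto
    then have "card A < card J" "card B < card J"
      using less.prems by (simp_all add: psubset_card_mono)
    then have "Q A" "Q B"
      using * less.hyps by blast+
    from AB show ?thesis
    proof
      assume "split_by E J A B"
      then show ?thesis
        unfolding *(4) using * \<open>Q A\<close> \<open>Q B\<close> by (intro assms(6)) (auto simp: split_by_def)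
    next
      assume "split_by (\<lambda>i j. \<not> E i j) J A B"
      then show ?thesis
        unfolding *(4) using * \<open>Q A\<close> \<open>Q B\<close> by (intro assms(7)) (auto simp: split_by_def)
    qed
  next
    case False
    then have "card J = 1"
      using less.prems card_gt_0_iff[of J] by linarith
    then show ?thesis
      using assms(5) by (auto simp: card_1_singleton_iff)
  qed
qed

text \<open>Graphs without induced paths on four vertices are perfect: the clique inequalities cut out
  the down-closure of the stable set polytope.\<close>

lemma clique_bound_imp_dominated:
  fixes x :: "real ^ 'n::finite"
  assumes "symp E" "path4_free E" "finite J" "J \<noteq> {}"
    and "\<mu> \<ge> 0" "\<And>i. 0 \<le> x $ i" "\<And>K. K \<subseteq> J \<Longrightarrow> clique E K \<Longrightarrow> (\<Sum>i\<in>K. x $ i) \<le> \<mu>"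
  shows "\<exists>z \<in> convex hull (ind ` {S. S \<subseteq> J \<and> stable_set E S}). \<forall>i\<in>J. x $ i \<le> \<mu> * z $ i"
  using assms(1-4) assms(5,7)
\<comment> \<open>The bound is generalized because the two sides of a join share it as
  \<open>l\<close> and \<open>\<mu> - l\<close>.\<close>
proof (induction J arbitrary: \<mu> rule: path4_free_induct)
  case (singleton i)
  have "x $ i \<le> \<mu>"
    using singleton(2)[of "{i}"] by (simp add: clique_def)
  moreover have "ind {i} \<in> convex hull (ind ` {S. S \<subseteq> {i} \<and> stable_set E S})"
    by (intro hull_inc imageI) (auto simp: stable_set_def)
  ultimately show ?case
    by (intro bexI[of _ "ind {i}"]) auto
next
  case (join A B)
  define C where "C = (\<lambda>K. \<Sum>i\<in>K. x $ i) ` {K. K \<subseteq> A \<and> clique E K}"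
  have C: "finite C" "C \<noteq> {}"
    using join by (auto simp: C_def clique_def)
  \<comment> \<open>A heaviest clique of \<open>A\<close> together with any clique of
    \<open>B\<close> is a clique, so cliques of \<open>B\<close> weigh at most
    \<open>\<mu> - l\<close>.\<close>
  define l where "l = Max C"
  have "l \<in> C"
    using Max_in C by (simp add: l_def)
  then obtain K0 where K0: "K0 \<subseteq> A" "clique E K0" "l = (\<Sum>i\<in>K0. x $ i)"
    by (auto simp: C_def)
  have l0: "l \<ge> 0"
    using assms(6) by (simp add: K0 sum_nonneg)
  have lA: "(\<Sum>i\<in>K. x $ i) \<le> l" if "K \<subseteq> A" "clique E K" for K
    unfolding l_def using that C by (intro Max_ge) (auto simp: C_def)
  have lB: "l + (\<Sum>i\<in>K. x $ i) \<le> \<mu>" if K: "K \<subseteq> B" "clique E K" for K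
  proof -
    have "l + (\<Sum>i\<in>K. x $ i) = (\<Sum>i\<in>K0 \<union> K. x $ i)"
      unfolding K0(3) using K0 K join by (intro sum.union_disjoint[symmetric]) (auto intro: finite_subset)
    also have "\<dots> \<le> \<mu>"
    proof (rule join.prems(2))
      show "K0 \<union> K \<subseteq> A \<union> B"
        using K0 K by auto
      have "E i j" if "i \<in> K0" "j \<in> K" for i j
        using that K0(1) K(1) by (intro join.hyps) auto
      moreover have "E j i" if "i \<in> K0" "j \<in> K" for i j
        using that calculation[of i j] sympD[OF \<open>symp E\<close>, of i j] by blast
      ultimately show "clique E (K0 \<union> K)"
        using K0 K unfolding clique_def by blast
    qed
    finally show ?thesis .
  qed
  have l1: "l \<le> \<mu>"
    using lB[of "{}"] by (simp add: clique_def)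
  let ?H = "convex hull (ind ` {S. S \<subseteq> A \<union> B \<and> stable_set E S}) :: (real ^ 'n) set"
  have "convex hull (ind ` {S. S \<subseteq> A \<and> stable_set E S}) \<subseteq> ?H" "convex hull (ind ` {S. S \<subseteq> B \<and> stable_set E S}) \<subseteq> ?H"
    by (intro hull_mono; auto)+
  moreover obtain u where "u \<in> convex hull (ind ` {S. S \<subseteq> A \<and> stable_set E S})" and uA: "\<forall>i\<in>A. x $ i \<le> l * u $ i"
    using join.IH(1)[OF l0 lA] by blast
  moreover obtain v where "v \<in> convex hull (ind ` {S. S \<subseteq> B \<and> stable_set E S})" and vB: "\<forall>i\<in>B. x $ i \<le> (\<mu> - l) * v $ i"
  proof -
    have "(\<Sum>i\<in>K. x $ i) \<le> \<mu> - l" if "K \<subseteq> B" "clique E K" for K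
      using lB[OF that] by simp
    then show ?thesis
      using join.IH(2)[of "\<mu> - l"] l1 that by auto
  qed
  ultimately have uv: "u \<in> ?H" "v \<in> ?H"
    by auto
  have "?H \<subseteq> {z. \<forall>i. 0 \<le> z $ i}"
    by (rule hull_minimal) (auto simp: convex_def)
  with uv have pos: "\<And>i. 0 \<le> u $ i" "\<And>i. 0 \<le> v $ i"
    by auto
  show ?case
  proof (cases "\<mu> = 0")
    case True
    then show ?thesis
      using l0 l1 uA vB uv by (intro bexI[of _ u]) auto
  next
    case False
    define w where "w = (l / \<mu>) *\<^sub>R u + ((\<mu> - l) / \<mu>) *\<^sub>R v"
    have "w \<in> ?H"
      unfolding w_def using False l0 l1 uv by (intro convexD[OF convex_convex_hull]) (auto simp: field_simps)
    moreover have "\<mu> * w $ i = l * u $ i + (\<mu> - l) * v $ i" for i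
      using False by (simp add: w_def distrib_left)
    moreover have "x $ i \<le> l * u $ i + (\<mu> - l) * v $ i" if "i \<in> A \<union> B" for i
      using that uA vB pos[of i] l0 l1 by (auto intro: add_increasing add_increasing2)
    ultimately show ?thesis
      by (intro bexI[of _ w]) auto
  qed
next
  case (union A B)
  let ?I = "\<lambda>J. ind ` {S. S \<subseteq> J \<and> stable_set E S} :: (real ^ 'n) set"
  obtain u where u: "u \<in> convex hull ?I A" and uA: "\<forall>i\<in>A. x $ i \<le> \<mu> * u $ i"
    using union.IH(1)[OF union.prems(1)] union.prems(2) by (meson le_supI1)
  obtain v where v: "v \<in> convex hull ?I B" and vB: "\<forall>i\<in>B. x $ i \<le> \<mu> * v $ i"
    using union.IH(2)[OF union.prems(1)] union.prems(2) by (meson le_supI2)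
  \<comment> \<open>Stable sets of the two sides unite to stable sets, and convex hulls commute with
    sums of sets.\<close>
  have "?I A + ?I B \<subseteq> ?I (A \<union> B)"
  proof
    fix z
    assume "z \<in> ?I A + ?I B"
    then obtain S T where ST: "S \<subseteq> A" "T \<subseteq> B" "stable_set E S" "stable_set E T" "z = ind S + ind T"
      by (auto simp: set_plus_def)
    then have "z = ind (S \<union> T)"
      using union by (auto simp: vec_eq_iff)
    moreover have "stable_set E (S \<union> T)"
    proof -
      have "\<not> E i j" "\<not> E j i" if "i \<in> S" "j \<in> T" for i j
        using that ST union sympD[OF \<open>symp E\<close>, of j i] by blast+
      then show ?thesis
        using ST unfolding stable_set_def by blast
    qed
    ultimately show "z \<in> ?I (A \<union> B)"
      using ST by auto
  qed
  then have "convex hull ?I A + convex hull ?I B \<subseteq> convex hull ?I (A \<union> B)"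
    unfolding convex_hull_set_plus[symmetric] by (rule hull_mono)
  then have "u + v \<in> convex hull ?I (A \<union> B)"
    using u v by (auto simp: set_plus_def)
  moreover have "convex hull ?I J \<subseteq> {z. \<forall>i. 0 \<le> z $ i}" for J
    by (rule hull_minimal) (auto simp: convex_def)
  then have "\<And>i. 0 \<le> u $ i" "\<And>i. 0 \<le> v $ i"
    using u v by auto
  then have "x $ i \<le> \<mu> * (u + v) $ i" if "i \<in> A \<union> B" for i
    using that uA vB union.prems(1) by (auto simp: distrib_left intro: add_increasing add_increasing2)
  ultimately show ?case by blast
qed

section \<open>The case of equality\<close>

lemma norm_axis: "norm (axis i r :: real ^ 'n::finite) = \<bar>r\<bar>"
proof -
  have "(axis i r :: real ^ 'n) = r *\<^sub>R axis i 1"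
    by (simp add: vec_eq_iff axis_def)
  then show ?thesis by simp
qed

section \<open>Rescaling each orthant to a pair of polar anti-blocking bodies\<close>

context lab_polytope
begin

definition tip :: "'n \<Rightarrow> real \<Rightarrow> real" where
  "tip i s = Sup {t. axis i (s * t) \<in> P}"

lemma tip_props:
  assumes s: "s = 1 \<or> s = -1"
  shows "tip i s > 0" "axis i (s * t) \<in> P \<Longrightarrow> t \<le> tip i s" "axis i (s * tip i s) \<in> P"
proof -
  let ?T = "{t. axis i (s * t) \<in> P}"
  have lin: "axis i (s * t) = t *\<^sub>R (axis i s :: real ^ 'n)" for t
    by (simp add: vec_eq_iff axis_def)
  have cl: "closed ?T"
  proof -
    have "?T = (\<lambda>t. t *\<^sub>R axis i s) -` P"
      by (auto simp: lin)
    moreover have "continuous_on UNIV (\<lambda>t. t *\<^sub>R (axis i s :: real ^ 'n))"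
      by (intro continuous_intros)
    ultimately show ?thesis
      using compact_imp_closed[OF compact_P] by (simp add: closed_vimage)
  qed
  obtain B where B: "\<And>x. x \<in> P \<Longrightarrow> norm x \<le> B"
    using compact_imp_bounded[OF compact_P] by (auto simp: bounded_iff)
  then have bd: "bdd_above ?T"
  proof (intro bdd_aboveI)
    fix t assume "t \<in> ?T"
    then have "norm (axis i (s * t) :: real ^ 'n) \<le> B"
      using B by simp
    then show "t \<le> B"
      using s by (auto simp: norm_axis)
  qed
  have "0 \<in> ?T"
  proof -
    have "axis i (s * 0) = (0 :: real ^ 'n)"
      by (simp add: vec_eq_iff axis_def)
    then show ?thesis
      by (simp only: mem_Collect_eq zero_P)
  qed
  then have ne: "?T \<noteq> {}"
    by blast
  have mem: "tip i s \<in> ?T"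
    unfolding tip_def by (rule closed_contains_Sup[OF ne bd cl])
  have upper: "t \<le> tip i s" if "t \<in> ?T" for t
    unfolding tip_def by (rule cSup_upper[OF that bd])
  from mem show "axis i (s * tip i s) \<in> P" by simp
  show "axis i (s * t) \<in> P \<Longrightarrow> t \<le> tip i s" for t
    using upper by simp
  obtain e where e: "e > 0" "ball 0 e \<subseteq> P"
    using zero_interior by (auto simp: mem_interior)
  have "(axis i (s * (e / 2)) :: real ^ 'n) \<in> ball 0 e"
    using e(1) s by (auto simp: norm_axis)
  then have "e / 2 \<in> ?T"
    using e(2) by blast
  then have "e / 2 \<le> tip i s"
    by (rule upper)
  with e(1) show "tip i s > 0" by simp
qed

text \<open>For a vector \<sigma> of signs 1 and -1, this maps the nonnegative orthant onto the
  orthant of \<sigma> and the unit vectors to the tips of \<open>P\<close>.\<close>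

definition scl :: "('n \<Rightarrow> real) \<Rightarrow> real ^ 'n \<Rightarrow> real ^ 'n" where
  "scl \<sigma> u = (\<chi> i. \<sigma> i * tip i (\<sigma> i) * u $ i)"

definition orthant :: "('n \<Rightarrow> real) \<Rightarrow> (real ^ 'n) set" where
  "orthant \<sigma> = {u. (\<forall>i. 0 \<le> u $ i) \<and> scl \<sigma> u \<in> P}"

definition orthant_polar :: "('n \<Rightarrow> real) \<Rightarrow> (real ^ 'n) set" where
  "orthant_polar \<sigma> = {v. (\<forall>i. 0 \<le> v $ i) \<and> (\<forall>u\<in>orthant \<sigma>. u \<bullet> v \<le> 1)}"

definition full_signs :: "('n \<Rightarrow> real) set" where
  "full_signs = {\<sigma>. \<forall>i. \<sigma> i = 1 \<or> \<sigma> i = -1}"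

lemma full_signsD: "\<sigma> \<in> full_signs \<Longrightarrow> \<sigma> i = 1 \<or> \<sigma> i = -1"
  by (simp add: full_signs_def)

lemma scl_nth: "scl \<sigma> u $ i = \<sigma> i * tip i (\<sigma> i) * u $ i"
  by (simp add: scl_def)

lemma axis_orthant:
  assumes "\<sigma> \<in> full_signs"
  shows "axis i 1 \<in> orthant \<sigma>"
proof -
  have "scl \<sigma> (axis i 1) = axis i (\<sigma> i * tip i (\<sigma> i))"
    by (auto simp: vec_eq_iff scl_nth axis_def)
  then show ?thesis
    using tip_props(3)[OF full_signsD[OF assms], of i i] by (simp add: orthant_def axis_def)
qed

lemma proj_orthant:
  assumes "u \<in> orthant \<sigma>"
  shows "coord_proj J u \<in> orthant \<sigma>"
proof -
  have "scl \<sigma> (coord_proj J u) = coord_proj J (scl \<sigma> u)"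
    by (simp add: vec_eq_iff scl_nth coord_proj_def)
  moreover have "0 \<le> coord_proj J u $ i" for i
    using assms by (simp add: orthant_def coord_proj_def)
  ultimately show ?thesis
    using assms proj_P[of "scl \<sigma> u" J] by (simp add: orthant_def)
qed

lemma orthant_nth_le:
  assumes "\<sigma> \<in> full_signs" "u \<in> orthant \<sigma>"
  shows "u $ i \<le> 1"
proof -
  have "scl \<sigma> (coord_proj {i} u) = axis i (\<sigma> i * (tip i (\<sigma> i) * u $ i))"
    by (auto simp: vec_eq_iff scl_nth coord_proj_def axis_def)
  then have "tip i (\<sigma> i) * u $ i \<le> tip i (\<sigma> i)"
    using proj_orthant[OF assms(2), of "{i}"] tip_props(2)[OF full_signsD[OF assms(1)], of i i "tip i (\<sigma> i) * u $ i"]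
    by (simp add: orthant_def)
  then show ?thesis
    using tip_props(1)[OF full_signsD[OF assms(1)], of i i] by simp
qed

lemma axis_orthant_polar:
  assumes "\<sigma> \<in> full_signs"
  shows "axis i 1 \<in> orthant_polar \<sigma>"
proof -
  have "0 \<le> (axis i 1 :: real ^ 'n) $ k" for k
    by (simp add: axis_def)
  then show ?thesis
    using orthant_nth_le[OF assms] by (simp add: orthant_polar_def inner_axis)
qed

text \<open>A separating functional for \<open>P\<close> stays separating when its components pointing
  out of the orthant are dropped.\<close>

lemma orthant_bipolar:
  assumes \<sigma>: "\<sigma> \<in> full_signs" and u: "\<And>i. 0 \<le> u $ i" "\<And>v. v \<in> orthant_polar \<sigma> \<Longrightarrow> u \<bullet> v \<le> 1"
  shows "u \<in> orthant \<sigma>"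
proof (rule ccontr)
  assume "u \<notin> orthant \<sigma>"
  then have "scl \<sigma> u \<notin> P"
    using u(1) by (simp add: orthant_def)
  then obtain a b where ab: "a \<bullet> scl \<sigma> u < b" "\<And>x. x \<in> P \<Longrightarrow> b < a \<bullet> x"
    using separating_hyperplane_closed_point[OF convex_P compact_imp_closed[OF compact_P]] by blast
  have b: "b < 0"
    using ab(2)[OF zero_P] by simp
  \<comment> \<open>As \<open>b\<close> is negative, division by it turns the separation into an
    inequality with right-hand side 1; \<open>w\<close> is the functional in rescaled
    coordinates.\<close>
  define w where "w i = a $ i / b * (\<sigma> i * tip i (\<sigma> i))" for i
  define v where "v = (\<chi> i. max 0 (w i))"
  have w: "a \<bullet> scl \<sigma> x = b * (\<Sum>i\<in>UNIV. x $ i * w i)" for x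
    using b by (simp add: inner_vec_def scl_nth w_def sum_distrib_left mult_ac)
  have "v \<in> orthant_polar \<sigma>"
    unfolding orthant_polar_def
  proof (intro CollectI conjI ballI allI)
    fix x assume x: "x \<in> orthant \<sigma>"
    define x' where "x' = coord_proj {i. w i \<ge> 0} x"
    have "x' \<in> orthant \<sigma>"
      unfolding x'_def using x by (rule proj_orthant)
    then have "b < b * (\<Sum>i\<in>UNIV. x' $ i * w i)"
      using ab(2)[of "scl \<sigma> x'"] by (simp add: orthant_def w)
    then have "(\<Sum>i\<in>UNIV. x' $ i * w i) \<le> 1"
      using b by (smt (verit) mult_le_cancel_left1)
    moreover have "x \<bullet> v = (\<Sum>i\<in>UNIV. x' $ i * w i)"
      unfolding inner_vec_def by (rule sum.cong) (auto simp: v_def x'_def coord_proj_def max_def)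
    ultimately show "x \<bullet> v \<le> 1" by simp
  qed (simp add: v_def)
  then have "u \<bullet> v \<le> 1"
    by (rule u(2))
  moreover have "(\<Sum>i\<in>UNIV. u $ i * w i) \<le> u \<bullet> v"
    unfolding inner_vec_def by (rule sum_mono) (use u(1) in \<open>auto simp: v_def intro!: mult_left_mono\<close>)
  ultimately have "(\<Sum>i\<in>UNIV. u $ i * w i) \<le> 1"
    by simp
  then have "b * (\<Sum>i\<in>UNIV. u $ i * w i) \<ge> b * 1"
    using b by (intro mult_left_mono_neg) auto
  then show False
    using ab(1) w[of u] by simp
qed

text \<open>The normal vector is \<open>y\<close> transported so that its product with
  \<open>scl \<sigma> u\<close> is \<open>u \<bullet> y\<close>. A point of \<open>P\<close> outside
  the orthant is first projected to its coordinates of the right sign, which does not lower the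
  product.\<close>

lemma orthant_good_pair:
  assumes \<sigma>: "\<sigma> \<in> full_signs" and x: "x \<in> orthant \<sigma>" and y: "y \<in> orthant_polar \<sigma>" and "x \<bullet> y = 1"
    and S: "\<And>i. x $ i \<noteq> 0 \<longleftrightarrow> i \<in> S" "\<And>i. y $ i \<noteq> 0 \<longleftrightarrow> i \<in> S"
  shows "good_pair (\<lambda>i. if i \<in> S then \<sigma> i else 0) (scl \<sigma> x) (\<chi> i. y $ i / (\<sigma> i * tip i (\<sigma> i)))"
    (is "good_pair ?\<tau> _ ?a")
proof -
  have c: "\<sigma> i * tip i (\<sigma> i) \<noteq> 0" "tip i (\<sigma> i) > 0" for i
    using tip_props(1)[OF full_signsD[OF \<sigma>, of i], of i] full_signsD[OF \<sigma>, of i] by auto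
  have a_scl: "?a \<bullet> scl \<sigma> u = u \<bullet> y" for u
    unfolding inner_vec_def by (rule sum.cong) (use c in \<open>auto simp: scl_nth\<close>)
  have xpos: "x $ i \<ge> 0" and ypos: "y $ i \<ge> 0" for i
    using x y by (auto simp: orthant_def orthant_polar_def)
  have "?a \<bullet> z \<le> ?a \<bullet> scl \<sigma> x" if z: "z \<in> P" for z
  proof -
    define z' where "z' = coord_proj {i. \<sigma> i * z $ i \<ge> 0} z"
    define u where "u = (\<chi> i. z' $ i / (\<sigma> i * tip i (\<sigma> i)))"
    have "scl \<sigma> u = z'"
      using c(1) by (simp add: vec_eq_iff scl_nth u_def)
    moreover have "0 \<le> u $ i" for i
      using c(2)[of i] full_signsD[OF \<sigma>, of i] by (auto simp: u_def z'_def coord_proj_def zero_le_divide_iff divide_le_0_iff)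
    ultimately have "u \<in> orthant \<sigma>"
      using proj_P[OF z] by (simp add: orthant_def z'_def)
    then have "u \<bullet> y \<le> 1"
      using y by (simp add: orthant_polar_def)
    moreover have "?a \<bullet> z \<le> ?a \<bullet> z'"
      unfolding inner_vec_def
    proof (rule sum_mono)
      fix i
      show "?a $ i \<bullet> z $ i \<le> ?a $ i \<bullet> z' $ i"
      proof (cases "\<sigma> i * z $ i \<ge> 0")
        case False
        have "y $ i / (\<sigma> i * tip i (\<sigma> i)) * z $ i = (\<sigma> i * z $ i) * (y $ i / tip i (\<sigma> i))"
          using full_signsD[OF \<sigma>, of i] by auto
        also have "\<dots> \<le> 0"
          using False c(2)[of i] ypos[of i] by (intro mult_nonpos_nonneg[of "\<sigma> i * z $ i"]) auto
        finally show ?thesis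
          using False by (simp add: z'_def coord_proj_def)
      qed (simp add: z'_def coord_proj_def)
    qed
    ultimately show ?thesis
      using a_scl[of u] a_scl[of x] \<open>scl \<sigma> u = z'\<close> \<open>x \<bullet> y = 1\<close> by simp
  qed
  moreover have "sgn (scl \<sigma> x $ i) = ?\<tau> i" for i
  proof -
    have "sgn (x $ i) = (if i \<in> S then 1 else 0)"
      using S(1)[of i] xpos[of i] by (auto simp: sgn_if)
    then show ?thesis
      using c(2)[of i] full_signsD[OF \<sigma>, of i] by (auto simp: scl_nth sgn_mult)
  qed
  moreover have "sgn (?a $ i) = ?\<tau> i" for i
  proof -
    have "sgn (y $ i) = (if i \<in> S then 1 else 0)"
      using S(2)[of i] ypos[of i] by (auto simp: sgn_if)
    then show ?thesis
      using c(2)[of i] full_signsD[OF \<sigma>, of i] by (auto simp: sgn_divide sgn_mult)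
  qed
  ultimately show ?thesis
    using x by (auto simp: good_pair_def orthant_def)
qed

end

context min_lab_polytope
begin

text \<open>Polarity comes from \<open>orthant_bipolar\<close>, and the tightness condition is
  \<open>good_pairs_tight\<close> for the transported pairs.\<close>

lemma dual_pair_orthant:
  assumes \<sigma>: "\<sigma> \<in> full_signs"
  shows "dual_pair (orthant \<sigma>) (orthant_polar \<sigma>)"
proof
  show "x \<in> orthant \<sigma> \<longleftrightarrow> (\<forall>i. 0 \<le> x $ i) \<and> (\<forall>y\<in>orthant_polar \<sigma>. x \<bullet> y \<le> 1)" for x
    using orthant_bipolar[OF \<sigma>, of x] by (auto simp: orthant_polar_def orthant_def)
  show "y \<in> orthant_polar \<sigma> \<longleftrightarrow> (\<forall>i. 0 \<le> y $ i) \<and> (\<forall>x\<in>orthant \<sigma>. x \<bullet> y \<le> 1)" for y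
    by (simp add: orthant_polar_def)
  show "axis i 1 \<in> orthant \<sigma>" "axis i 1 \<in> orthant_polar \<sigma>" for i
    using axis_orthant[OF \<sigma>] axis_orthant_polar[OF \<sigma>] by auto
  fix x x' y y' and S :: "'n set"
  assume mem: "x \<in> orthant \<sigma>" "x' \<in> orthant \<sigma>" "y \<in> orthant_polar \<sigma>" "y' \<in> orthant_polar \<sigma>"
    and tight: "x \<bullet> y = 1" "x' \<bullet> y' = 1"
    and S: "\<And>i. x $ i \<noteq> 0 \<longleftrightarrow> i \<in> S" "\<And>i. x' $ i \<noteq> 0 \<longleftrightarrow> i \<in> S"
      "\<And>i. y $ i \<noteq> 0 \<longleftrightarrow> i \<in> S" "\<And>i. y' $ i \<noteq> 0 \<longleftrightarrow> i \<in> S"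
  have c: "\<sigma> i * tip i (\<sigma> i) \<noteq> 0" for i
    using tip_props(1)[OF full_signsD[OF \<sigma>, of i], of i] full_signsD[OF \<sigma>, of i] by auto
  have a_scl: "(\<chi> i. y' $ i / (\<sigma> i * tip i (\<sigma> i))) \<bullet> scl \<sigma> u = u \<bullet> y'" for u
    unfolding inner_vec_def by (rule sum.cong) (use c in \<open>auto simp: scl_nth\<close>)
  show "x \<bullet> y' = 1"
    using good_pairs_tight[OF orthant_good_pair[OF \<sigma> mem(1,3) tight(1) S(1,3)]
        orthant_good_pair[OF \<sigma> mem(2,4) tight(2) S(2,4)]] tight(2)
    by (simp only: a_scl)
qed

section \<open>Two-dimensional coordinate sections and the graph they define\<close>

definition rect :: "'n \<Rightarrow> real \<Rightarrow> 'n \<Rightarrow> real \<Rightarrow> bool" where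
  "rect i s j t \<longleftrightarrow> axis i (s * tip i s) + axis j (t * tip j t) \<in> P"

lemma rect_sym: "rect i s j t \<longleftrightarrow> rect j t i s"
  by (simp add: rect_def add.commute)

lemma rect_orthant:
  assumes "i \<noteq> j" "\<sigma> \<in> full_signs"
  shows "ind {i, j} \<in> orthant \<sigma> \<longleftrightarrow> rect i (\<sigma> i) j (\<sigma> j)"
proof -
  have "scl \<sigma> (ind {i, j}) = axis i (\<sigma> i * tip i (\<sigma> i)) + axis j (\<sigma> j * tip j (\<sigma> j))"
    using assms(1) by (auto simp: vec_eq_iff scl_nth axis_def)
  then show ?thesis
    by (simp add: orthant_def rect_def)
qed

text \<open>If the section by the plane of \<open>i\<close> and \<open>j\<close> were rectangular in one quadrant but triangular
  in the adjacent one, then the face where the coordinate \<open>i\<close> is extremal could not be good.\<close>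

lemma rect_flip:
  assumes ij: "i \<noteq> j" and s: "s = 1 \<or> s = -1" and t: "t = 1 \<or> t = -1" and rect: "rect i s j t"
  shows "rect i s j (- t)"
proof (rule ccontr)
  assume nrect: "\<not> rect i s j (- t)"
  define \<sigma> where "\<sigma> = (\<lambda>k. if k = i then s else if k = j then - t else 1)"
  have \<sigma>: "\<sigma> \<in> full_signs"
    using s t by (auto simp: full_signs_def \<sigma>_def)
  interpret dual_pair "orthant \<sigma>" "orthant_polar \<sigma>"
    using \<sigma> by (rule dual_pair_orthant)
  have "ind {i, j} \<in> orthant_polar \<sigma>"
    using ind_pair_cases[OF ij] rect_orthant[OF ij \<sigma>] nrect ij by (simp add: \<sigma>_def)
  define F where "F = P \<inter> {x. axis i s \<bullet> x = tip i s}"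
  have bound: "axis i s \<bullet> x \<le> tip i s" if "x \<in> P" for x
  proof -
    have "coord_proj {i} x = axis i (s * (s * x $ i))"
      using s by (auto simp: vec_eq_iff coord_proj_def axis_def)
    then have "s * x $ i \<le> tip i s"
      using proj_P[OF that, of "{i}"] tip_props(2)[OF s, of i "s * x $ i"] by simp
    then show ?thesis
      by (simp add: inner_axis' )
  qed
  have face: "F face_of P"
    unfolding F_def using bound by (intro face_of_Int_supporting_hyperplane_le[OF convex_P])
  define p where "p = (axis i (s * tip i s) :: real ^ 'n)"
  define q where "q = p + axis j (t * tip j t)"
  have pF: "p \<in> F"
    using tip_props(3)[OF s, of i] s by (auto simp: F_def p_def inner_axis_axis)
  have qF: "q \<in> F"
    using rect s ij by (auto simp: F_def q_def p_def rect_def inner_axis_axis inner_add_right)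
  obtain \<tau> z a where z: "z \<in> rel_interior F" and good: "good_pair \<tau> z a"
    using every_face_good[of F] face pF by (auto simp: good_face_def)
  \<comment> \<open>The tip \<open>p\<close> and the corner \<open>q\<close> of \<open>F\<close>
    differ only in coordinate \<open>j\<close>, so a normal constant on \<open>F\<close> vanishes
    there; goodness passes this zero on to \<open>z\<close>.\<close>
  have "a \<bullet> p = a \<bullet> q"
    using good_pair_const_on_face[OF face z good] pF qF by simp
  then have "a $ j * (t * tip j t) = 0"
    by (simp add: q_def inner_add_right inner_axis)
  then have "a $ j = 0"
    using tip_props(1)[OF t, of j] t by auto
  then have zj: "z $ j = 0"
    using good by (metis good_pair_def sgn_eq_0_iff)
  have "z \<in> F"
    using z rel_interior_subset by blast
  \<comment> \<open>Prolonging from \<open>q\<close> beyond \<open>z\<close> enters the adjacent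
    quadrant while coordinate \<open>i\<close> stays extremal, which the triangle there
    forbids.\<close>
  obtain e where e: "e > 0" "z + e *\<^sub>R (z - q) \<in> F"
    using rel_interior_prolong[OF face_of_imp_convex[OF face] z qF] .
  define u where "u = z + e *\<^sub>R (z - q)"
  have uj: "u $ j = - e * t * tip j t"
    using zj ij by (simp add: u_def q_def p_def axis_def)
  have "u \<in> P" "s * u $ i = tip i s"
    using e(2) by (auto simp: u_def[symmetric] F_def inner_axis')
  then have ui: "u $ i = s * tip i s"
    using s by auto
  have ppos: "tip j t > 0" "tip j (- t) > 0"
    using tip_props(1) t by (metis add.inverse_inverse)+
  define n where "n = (\<chi> k. if k = i then 1 else if k = j then e * tip j t / tip j (- t) else 0)"
  have "scl \<sigma> n = coord_proj {i, j} u"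
    using ij ppos ui uj by (auto simp: vec_eq_iff scl_nth coord_proj_def n_def \<sigma>_def)
  moreover have "0 \<le> n $ k" for k
    using e(1) ppos by (simp add: n_def)
  ultimately have "n \<in> orthant \<sigma>"
    using proj_P[OF \<open>u \<in> P\<close>] by (simp add: orthant_def)
  then have "n \<bullet> ind {i, j} \<le> 1"
    using \<open>ind {i, j} \<in> orthant_polar \<sigma>\<close> by (rule inner_le)
  moreover have "n \<bullet> ind {i, j} = 1 + e * tip j t / tip j (- t)"
    using ij by (simp add: inner_ind n_def)
  ultimately show False
    using e(1) ppos by (simp add: divide_le_0_iff mult_le_0_iff)
qed

lemma rect_all_signs:
  assumes "i \<noteq> j" "s = 1 \<or> s = -1" "t = 1 \<or> t = -1"
  shows "rect i s j t \<longleftrightarrow> rect i 1 j 1"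
proof -
  have flip: "rect i s j t \<longleftrightarrow> rect i s j (- t)" if "i \<noteq> j" "s = 1 \<or> s = -1" "t = 1 \<or> t = -1" for i j s t
    using rect_flip[OF that] rect_flip[OF that(1,2), of "- t"] that(3) by auto
  have "rect i s j t \<longleftrightarrow> rect i s j 1"
    using flip[OF assms] assms(3) by auto
  also have "\<dots> \<longleftrightarrow> rect i 1 j 1"
    using flip[of j i 1 s] assms(1,2) by (auto simp: rect_sym[of i])
  finally show ?thesis .
qed

definition adj :: "'n \<Rightarrow> 'n \<Rightarrow> bool" where
  "adj i j \<longleftrightarrow> \<not> rect i 1 j 1"

lemma adj_orthant:
  assumes "i \<noteq> j" "\<sigma> \<in> full_signs"
  shows "adj i j \<longleftrightarrow> ind {i, j} \<in> orthant_polar \<sigma>" "\<not> adj i j \<longleftrightarrow> ind {i, j} \<in> orthant \<sigma>"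
  using dual_pair.ind_pair_cases[OF dual_pair_orthant[OF assms(2)] assms(1)] rect_orthant[OF assms]
    rect_all_signs[OF assms(1) full_signsD[OF assms(2)] full_signsD[OF assms(2)]]
  by (auto simp: adj_def)

lemma symp_adj: "symp adj"
  by (auto simp: symp_def adj_def rect_sym)

lemma path4_free_adj: "path4_free adj"
  unfolding path4_free_def
proof clarify
  fix i j k l
  assume *: "distinct [i, j, k, l]" "adj i j" "adj j k" "adj k l" "\<not> adj i k" "\<not> adj j l" "\<not> adj i l"
  have \<sigma>: "(\<lambda>_. 1) \<in> full_signs"
    by (simp add: full_signs_def)
  show False
    using dual_pair.no_induced_path4[OF dual_pair_orthant[OF \<sigma>] *(1)] * adj_orthant[OF _ \<sigma>] by simp
qed

text \<open>Clique inequalities are valid by \<open>ind_stable\<close> on the swapped pair.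
  Conversely, they place \<open>u\<close> below a convex combination of indicators of stable sets,
  which is in the orthant body, and this body is closed downwards.\<close>

lemma orthant_iff:
  assumes \<sigma>: "\<sigma> \<in> full_signs"
  shows "u \<in> orthant \<sigma> \<longleftrightarrow> (\<forall>i. 0 \<le> u $ i) \<and> (\<forall>K. clique adj K \<longrightarrow> (\<Sum>i\<in>K. u $ i) \<le> 1)"
proof -
  interpret dual_pair "orthant \<sigma>" "orthant_polar \<sigma>"
    using \<sigma> by (rule dual_pair_orthant)
  show ?thesis
  proof (intro iffI conjI allI impI)
    fix K assume u: "u \<in> orthant \<sigma>" and K: "clique adj K"
    have "ind K \<in> orthant_polar \<sigma>"
      using K adj_orthant(1)[OF _ \<sigma>] by (rule_tac dual_pair.ind_stable[OF swap]) (auto simp: clique_def)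
    then show "(\<Sum>i\<in>K. u $ i) \<le> 1"
      using inner_le[OF u, of "ind K"] by (simp add: inner_ind)
  next
    assume u: "(\<forall>i. 0 \<le> u $ i) \<and> (\<forall>K. clique adj K \<longrightarrow> (\<Sum>i\<in>K. u $ i) \<le> 1)"
    then obtain z where z: "z \<in> convex hull (ind ` {S. S \<subseteq> UNIV \<and> stable_set adj S})" "\<And>i. u $ i \<le> z $ i"
      using clique_bound_imp_dominated[OF symp_adj path4_free_adj, of UNIV 1 u] by auto
    have "ind ` {S. S \<subseteq> UNIV \<and> stable_set adj S} \<subseteq> orthant \<sigma>"
    proof clarify
      fix S :: "'n set" assume "stable_set adj S"
      then show "ind S \<in> orthant \<sigma>"
        using adj_orthant(2)[OF _ \<sigma>] by (rule_tac ind_stable) (auto simp: stable_set_def)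
    qed
    then have "z \<in> orthant \<sigma>"
      using z(1) hull_minimal[of _ "orthant \<sigma>" convex] convex_X by blast
    then show "u \<in> orthant \<sigma>"
      using u z(2) by (rule_tac down_closed_X[of z u]) auto
  qed (use nonneg_X in auto)
qed

section \<open>Clique inequalities for \<open>P\<close> and decomposition of its coordinate
  sections\<close>

definition weight :: "real ^ 'n \<Rightarrow> 'n \<Rightarrow> real" where
  "weight x i = \<bar>x $ i\<bar> / tip i (if x $ i \<ge> 0 then 1 else -1)"

lemma weight_nonneg: "0 \<le> weight x i"
  using tip_props(1)[of 1 i] tip_props(1)[of "-1" i] by (simp add: weight_def)

lemma weight_zero: "weight x i = 0 \<longleftrightarrow> x $ i = 0"
  using tip_props(1)[of 1 i] tip_props(1)[of "-1" i] by (auto simp: weight_def)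

lemma weight_cong: "x $ i = y $ i \<Longrightarrow> weight x i = weight y i"
  by (simp add: weight_def)

lemma weight_scaleR: "c \<ge> 0 \<Longrightarrow> weight (c *\<^sub>R x) i = c * weight x i"
  by (cases "c = 0") (auto simp: weight_def abs_mult zero_le_mult_iff)

text \<open>The weights are the rescaled coordinates of \<open>x\<close> in an orthant that contains
  it. As all orthants have the same graph, one system of inequalities describes
  \<open>P\<close>.\<close>

lemma mem_P_iff: "x \<in> P \<longleftrightarrow> (\<forall>K. clique adj K \<longrightarrow> (\<Sum>i\<in>K. weight x i) \<le> 1)"
proof -
  define \<sigma> where "\<sigma> i = (if x $ i \<ge> 0 then 1 else -1 :: real)" for i
  have \<sigma>: "\<sigma> \<in> full_signs"
    by (simp add: full_signs_def \<sigma>_def)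
  have "scl \<sigma> (\<chi> i. weight x i) $ i = x $ i" for i
    using tip_props(1)[of 1 i] tip_props(1)[of "-1" i] by (auto simp: scl_nth weight_def \<sigma>_def)
  then have "scl \<sigma> (\<chi> i. weight x i) = x"
    by (simp add: vec_eq_iff)
  then have "x \<in> P \<longleftrightarrow> (\<chi> i. weight x i) \<in> orthant \<sigma>"
    by (simp add: orthant_def weight_nonneg)
  then show ?thesis
    by (simp add: orthant_iff[OF \<sigma>] weight_nonneg)
qed

definition sect :: "'n set \<Rightarrow> (real ^ 'n) set" where
  "sect J = {x \<in> P. \<forall>i. i \<notin> J \<longrightarrow> x $ i = 0}"

lemma mem_sect_iff:
  assumes "\<And>i. i \<notin> J \<Longrightarrow> x $ i = 0"
  shows "x \<in> sect J \<longleftrightarrow> (\<forall>K. K \<subseteq> J \<longrightarrow> clique adj K \<longrightarrow> (\<Sum>i\<in>K. weight x i) \<le> 1)"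
proof -
  have "(\<Sum>i\<in>K \<inter> J. weight x i) = (\<Sum>i\<in>K. weight x i)" for K
    by (rule sum.mono_neutral_left) (auto simp: assms weight_zero)
  moreover have "clique adj (K \<inter> J)" if "clique adj K" for K
    using that by (auto simp: clique_def)
  ultimately show ?thesis
    unfolding sect_def mem_P_iff using assms
    by (smt (verit, best) inf_le2 mem_Collect_eq)
qed

text \<open>For positive \<open>c\<close> divide \<open>x\<close> by \<open>c\<close>; for
  \<open>c = 0\<close> the one-element cliques force \<open>x = 0\<close>.\<close>

lemma sect_scale:
  assumes "\<And>i. i \<notin> J \<Longrightarrow> x $ i = 0" "c \<ge> 0" "\<And>K. K \<subseteq> J \<Longrightarrow> clique adj K \<Longrightarrow> (\<Sum>i\<in>K. weight x i) \<le> c"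
  shows "\<exists>y\<in>sect J. x = c *\<^sub>R y"
proof (cases "c = 0")
  case True
  have "x $ i = 0" for i
  proof (cases "i \<in> J")
    case True
    then have "weight x i \<le> 0"
      using assms(3)[of "{i}"] \<open>c = 0\<close> by (simp add: clique_def)
    then show ?thesis
      using weight_nonneg[of x i] weight_zero by auto
  qed (use assms in auto)
  then have "x = 0"
    by (simp add: vec_eq_iff)
  then show ?thesis
    using True zero_P by (intro bexI[of _ 0]) (auto simp: sect_def)
next
  case False
  then have c: "c > 0"
    using assms by simp
  have "(1 / c) *\<^sub>R x \<in> sect J"
  proof (subst mem_sect_iff)
    show "\<forall>K\<subseteq>J. clique adj K \<longrightarrow> (\<Sum>i\<in>K. weight ((1 / c) *\<^sub>R x) i) \<le> 1"
    proof (intro allI impI)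
      fix K assume "K \<subseteq> J" "clique adj K"
      then have "(1 / c) * (\<Sum>i\<in>K. weight x i) \<le> 1"
        using assms(3)[of K] c by simp
      then show "(\<Sum>i\<in>K. weight ((1 / c) *\<^sub>R x) i) \<le> 1"
        using c by (simp add: weight_scaleR sum_divide_distrib[symmetric])
    qed
  qed (use assms in auto)
  then show ?thesis
    using c by (intro bexI[of _ "(1 / c) *\<^sub>R x"]) auto
qed

text \<open>A clique cannot meet both parts, so each clique inequality for a sum concerns one
  summand only. The other inclusion splits a point by projection.\<close>

lemma sect_union:
  assumes disj: "A \<inter> B = {}" and nadj: "\<And>a b. a \<in> A \<Longrightarrow> b \<in> B \<Longrightarrow> \<not> adj a b"
  shows "sect (A \<union> B) = {x + y | x y. x \<in> sect A \<and> y \<in> sect B}"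
proof
  show "sect (A \<union> B) \<subseteq> {x + y | x y. x \<in> sect A \<and> y \<in> sect B}"
  proof
    fix x assume x: "x \<in> sect (A \<union> B)"
    have "x = coord_proj A x + coord_proj B x"
      using x disj by (auto simp: vec_eq_iff coord_proj_def sect_def)
    moreover have "coord_proj A x \<in> sect A" "coord_proj B x \<in> sect B"
      using x proj_P[of x] by (auto simp: sect_def) (simp_all add: coord_proj_def)
    ultimately show "x \<in> {x + y | x y. x \<in> sect A \<and> y \<in> sect B}"
      by blast
  qed
next
  show "{x + y | x y. x \<in> sect A \<and> y \<in> sect B} \<subseteq> sect (A \<union> B)"
  proof clarify
    fix x y assume x: "x \<in> sect A" and y: "y \<in> sect B"
    have x0: "x $ i = 0" if "i \<notin> A" for i
      using x that by (simp add: sect_def)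
    have y0: "y $ i = 0" if "i \<notin> B" for i
      using y that by (simp add: sect_def)
    have "(\<Sum>i\<in>K. weight (x + y) i) \<le> 1" if K: "K \<subseteq> A \<union> B" "clique adj K" for K
    proof -
      have "K \<subseteq> A \<or> K \<subseteq> B"
      proof (rule ccontr)
        assume "\<not> ?thesis"
        then obtain a b where ab: "a \<in> K" "a \<notin> B" "b \<in> K" "b \<notin> A"
          by blast
        then have "a \<in> A" "b \<in> B" "a \<noteq> b"
          using K by auto
        moreover have "adj a b"
          using K(2) ab \<open>a \<noteq> b\<close> by (simp add: clique_def)
        ultimately show False
          using nadj by blast
      qed
      then show ?thesis
      proof
        assume KA: "K \<subseteq> A"
        have "(\<Sum>i\<in>K. weight (x + y) i) = (\<Sum>i\<in>K. weight x i)"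
          by (intro sum.cong refl weight_cong) (use KA disj y0 in auto)
        then show ?thesis
          using x KA K mem_sect_iff[OF x0] by auto
      next
        assume KB: "K \<subseteq> B"
        have "(\<Sum>i\<in>K. weight (x + y) i) = (\<Sum>i\<in>K. weight y i)"
          by (intro sum.cong refl weight_cong) (use KB disj x0 in auto)
        then show ?thesis
          using y KB K mem_sect_iff[OF y0] by auto
      qed
    qed
    then show "x + y \<in> sect (A \<union> B)"
      using x0 y0 by (subst mem_sect_iff) auto
  qed
qed

text \<open>The heaviest clique of \<open>A\<close> has weight \<open>l\<close> and leaves at most
  \<open>1 - l\<close> to cliques of \<open>B\<close>. The projections of \<open>x\<close> are thus
  these multiples of points of the two sections, and the factors are convex weights.\<close>

lemma sect_join:
  assumes disj: "A \<inter> B = {}" and adj: "\<And>a b. a \<in> A \<Longrightarrow> b \<in> B \<Longrightarrow> adj a b"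
  shows "sect (A \<union> B) = convex hull (sect A \<union> sect B)"
proof
  have "convex (sect (A \<union> B))"
    unfolding sect_def by (rule convexI) (auto intro: convexD[OF convex_P])
  moreover have "sect A \<union> sect B \<subseteq> sect (A \<union> B)"
    by (auto simp: sect_def)
  ultimately show "convex hull (sect A \<union> sect B) \<subseteq> sect (A \<union> B)"
    by (intro hull_minimal)
  show "sect (A \<union> B) \<subseteq> convex hull (sect A \<union> sect B)"
  proof
    fix x assume x: "x \<in> sect (A \<union> B)"
    define C where "C = (\<lambda>K. \<Sum>i\<in>K. weight x i) ` {K. K \<subseteq> A \<and> clique adj K}"
    have C: "finite C" "C \<noteq> {}"
      by (auto simp: C_def clique_def)
    define l where "l = Max C"
    have "l \<in> C"
      using Max_in C by (simp add: l_def)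
    then obtain K0 where K0: "K0 \<subseteq> A" "clique adj K0" "l = (\<Sum>i\<in>K0. weight x i)"
      by (auto simp: C_def)
    have l0: "l \<ge> 0"
      by (simp add: K0 sum_nonneg weight_nonneg)
    have lA: "(\<Sum>i\<in>K. weight x i) \<le> l" if "K \<subseteq> A" "clique adj K" for K
      unfolding l_def using that C by (intro Max_ge) (auto simp: C_def)
    have lB: "(\<Sum>i\<in>K. weight x i) \<le> 1 - l" if K: "K \<subseteq> B" "clique adj K" for K
    proof -
      have "adj i j" if "i \<in> K0" "j \<in> K" for i j
        using that K0(1) K(1) by (intro adj) auto
      moreover have "adj j i" if "i \<in> K0" "j \<in> K" for i j
        using calculation[OF that] sympD[OF symp_adj] by blast
      ultimately have "clique adj (K0 \<union> K)"
        using K0 K unfolding clique_def by blast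
      moreover have "x \<in> P"
        using x by (simp add: sect_def)
      ultimately have "(\<Sum>i\<in>K0 \<union> K. weight x i) \<le> 1"
        using mem_P_iff by blast
      moreover have "l + (\<Sum>i\<in>K. weight x i) = (\<Sum>i\<in>K0 \<union> K. weight x i)"
        unfolding K0(3) using K0 K disj by (intro sum.union_disjoint[symmetric]) auto
      ultimately show ?thesis by simp
    qed
    have l1: "0 \<le> 1 - l"
      using lB[of "{}"] by (simp add: clique_def)
    have wA: "(\<Sum>i\<in>K. weight (coord_proj J x) i) = (\<Sum>i\<in>K. weight x i)" if "K \<subseteq> J" for K J
      by (intro sum.cong refl weight_cong) (use that in \<open>auto simp: coord_proj_def\<close>)
    obtain y where y: "y \<in> sect A" "coord_proj A x = l *\<^sub>R y"
      using sect_scale[of A "coord_proj A x" l] l0 lA wA[of _ A] by (auto simp: coord_proj_def)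
    obtain z where z: "z \<in> sect B" "coord_proj B x = (1 - l) *\<^sub>R z"
      using sect_scale[of B "coord_proj B x" "1 - l"] l1 lB wA[of _ B] by (auto simp: coord_proj_def)
    have "x = coord_proj A x + coord_proj B x"
      using x disj by (auto simp: vec_eq_iff coord_proj_def sect_def)
    then have "x = l *\<^sub>R y + (1 - l) *\<^sub>R z"
      using y z by simp
    moreover have "y \<in> convex hull (sect A \<union> sect B)" "z \<in> convex hull (sect A \<union> sect B)"
      using y z by (auto intro: hull_inc)
    ultimately show "x \<in> convex hull (sect A \<union> sect B)"
      using l0 l1 convexD[OF convex_convex_hull, of y "sect A \<union> sect B" z l "1 - l"] by simp
  qed
qed

lemma sect_singleton: "sect {i} = closed_segment (axis i (- tip i (-1))) (axis i (tip i 1))"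
proof -
  have lin: "linear (axis i :: real \<Rightarrow> real ^ 'n)"
    by (rule linearI) (simp_all add: vec_eq_iff axis_def)
  have pos: "tip i 1 > 0" "tip i (-1) > 0"
    using tip_props(1)[of 1 i] tip_props(1)[of "-1" i] by auto
  have "axis i t \<in> P \<longleftrightarrow> - tip i (-1) \<le> t \<and> t \<le> tip i 1" for t
  proof
    assume "axis i t \<in> P"
    then show "- tip i (-1) \<le> t \<and> t \<le> tip i 1"
      using tip_props(2)[of 1 i t] tip_props(2)[of "-1" i "- t"] by auto
  next
    assume "- tip i (-1) \<le> t \<and> t \<le> tip i 1"
    then have "axis i t \<in> axis i ` closed_segment (- tip i (-1)) (tip i 1)"
      using pos by (auto simp: closed_segment_eq_real_ivl)
    also have "\<dots> = closed_segment (axis i (- tip i (-1))) (axis i (tip i 1))"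
      by (rule closed_segment_linear_image[OF lin, symmetric])
    also have "\<dots> \<subseteq> P"
      using tip_props(3)[of 1 i] tip_props(3)[of "-1" i] convex_P by (intro closed_segment_subset) auto
    finally show "axis i t \<in> P" .
  qed
  moreover have "sect {i} = {x. \<exists>t. x = axis i t \<and> axis i t \<in> P}"
  proof -
    have "x = axis i (x $ i)" if "\<forall>k. k \<notin> {i} \<longrightarrow> x $ k = 0" for x :: "real ^ 'n"
      using that by (auto simp: vec_eq_iff axis_def)
    then show ?thesis
      by (auto simp: sect_def axis_def) metis
  qed
  ultimately have "sect {i} = axis i ` {- tip i (-1)..tip i 1}"
    by auto
  also have "\<dots> = axis i ` closed_segment (- tip i (-1)) (tip i 1)"
    using pos by (simp add: closed_segment_eq_real_ivl)
  also have "\<dots> = closed_segment (axis i (- tip i (-1))) (axis i (tip i 1))"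
    by (rule closed_segment_linear_image[OF lin, symmetric])
  finally show ?thesis .
qed

lemma generalized_hanner_on_sect:
  assumes "J \<noteq> {}"
  shows "generalized_hanner_on J (sect J)"
  using symp_adj path4_free_adj finite[of J] assms
proof (induction J rule: path4_free_induct)
  case (singleton i)
  show ?case
    unfolding sect_singleton
    using tip_props(1)[of 1 i] tip_props(1)[of "-1" i] by (intro generalized_hanner_on.segment) auto
next
  case (join A B)
  then show ?case
    by (auto simp: sect_join intro: generalized_hanner_on.free_sum)
next
  case (union A B)
  then show ?case
    using sect_union[of A B] generalized_hanner_on.product[of A "sect A" B "sect B"] by simp
qed

lemma generalized_hanner_P: "generalized_hanner P"
proof -
  have "sect UNIV = P"
    by (auto simp: sect_def)
  then show ?thesis
    using generalized_hanner_on_sect[of UNIV] by (simp add: generalized_hanner_def)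
qed

end

theorem theorem1p4:
  fixes P :: "(real ^ 'n::finite) set"
  assumes "polytope P"
    and "locally_anti_blocking P"
    and "0 \<in> interior P"
  shows "num_nonempty_faces P \<ge> 3 ^ CARD('n) \<and>
    (num_nonempty_faces P = 3 ^ CARD('n) \<longleftrightarrow> generalized_hanner P)"
proof -
  interpret lab_polytope P
    using assms by unfold_locales
  have "generalized_hanner P" if "num_nonempty_faces P = 3 ^ CARD('n)"
  proof -
    interpret min_lab_polytope P
      using that by unfold_locales
    show ?thesis
      by (rule generalized_hanner_P)
  qed
  moreover have "num_nonempty_faces P \<le> 3 ^ CARD('n)" if "generalized_hanner P"
    using card_faces_hanner_le[of UNIV P] that by (simp add: generalized_hanner_def num_nonempty_faces_def)
  ultimately show ?thesis
    using card_faces_ge by (meson order_antisym)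
qed

end
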